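(* (i) For every integer $m\ge0$, with $\mathcal{L}$ acting on the variable $j$ only (the variable $X$ being treated as a constant), \[ B_{m+1,0}(X) = \mathcal{L}\Bigl( \tfrac{X(X-1728) A_{m+1,0}(X) - j(j-1728) A_{m+1,0}(j)}{X-j} \Bigr),\quad B_{m,2}(X) = \mathcal{L}\Bigl( \tfrac{A_{m,2}(X) - A_{m,2}(j)}{X-j} \Bigr), \] \[ B_{m,6}(X) = \mathcal{L}\Bigl( \tfrac{X A_{m,6}(X) - j A_{m,6}(j)}{X-j} \Bigr),\quad B_{m,8}(X) = \mathcal{L}\Bigl( \tfrac{(X-1728) A_{m,8}(X) - (j-1728) A_{m,8}(j)}{X-j} \Bigr). \] (ii) For every integer $m\ge0$, as formal power series in $Y^{-1}$, \[ \mathcal{L}\Bigl( \tfrac{j(j-1728) A_{m+1,0}(j)}{Y-j} \Bigr) = - N_{m+1,0}\, \frac{{}_{2}F_{1} ( m+\frac{13}{12}, m+\frac{17}{12} ; 2m+3 ; \frac{1728}{Y} ) }{Y^{m+1}\, {}_{2}F_{1} ( \frac{1}{12}, \frac{5}{12} ; 1 ; \frac{1728}{Y} ) },\quad \mathcal{L}\Bigl( \tfrac{A_{m,2}(j)}{Y-j} \Bigr) = N_{m,2}\, \frac{{}_{2}F_{1} ( m+\frac{5}{12}, m+\frac{13}{12} ; 2m+1 ; \frac{1728}{Y} ) }{Y^{m+1}\, {}_{2}F_{1} ( \frac{1}{12}, \frac{5}{12} ; 1 ; \frac{1728}{Y} ) }, \] \[ \mathcal{L}\Bigl( \tfrac{j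 A_{m,6}(j)}{Y-j} \Bigr) = N_{m,6}\, \frac{{}_{2}F_{1} ( m+\frac{13}{12}, m+\frac{17}{12} ; 2m+2 ; \frac{1728}{Y} ) }{Y^{m+1}\, {}_{2}F_{1} ( \frac{1}{12}, \frac{5}{12} ; 1 ; \frac{1728}{Y} ) },\quad \mathcal{L}\Bigl( \tfrac{(j-1728) A_{m,8}(j)}{Y-j} \Bigr) = - N_{m,8}\, \frac{{}_{2}F_{1} ( m+\frac{5}{12}, m+\frac{13}{12} ; 2m+2 ; \frac{1728}{Y} ) }{Y^{m+1}\, {}_{2}F_{1} ( \frac{1}{12}, \frac{5}{12} ; 1 ; \frac{1728}{Y} ) }. \] (iii) For all integers $m,n\ge0$, \[ \mathcal{L}\bigl( j(j-1728) A_{m+1,0}(j) A_{n+1,0}(j) \bigr) = - N_{m+1,0}\, \delta_{m,n},\qquad \mathcal{L}\bigl( A_{m,2}(j) A_{n,2}(j) \bigr) = N_{m,2}\, \delta_{m,n}, \] \[ \mathcal{L}\bigl( j A_{m,6}(j) A_{n,6}(j) \bigr) = N_{m,6}\, \delta_{m,n},\qquad \mathcal{L}\bigl( (j-1728) A_{m,8}(j) A_{n,8}(j) \bigr) = - N_{m,8}\, \delta_{m,n}, \] where $\delta_{m,n}$ is the Kronecker delta.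
   Context: Let $q=e^{2\pi i\tau}$, $E_2=1-24\sum_{n\ge1}\sigma_1(n)q^n$, $E_4=1+240\sum_{n\ge1}\sigma_3(n)q^n$, $E_6=1-504\sum_{n\ge1}\sigma_5(n)q^n$, $\Delta=(E_4^3-E_6^2)/1728$, $j=E_4^3/\Delta$. The linear functional $\mathcal{L}$ on polynomials in $j$ is $\mathcal{L}(P(j))=$ constant term of the $q$-Laurent expansion of $P(j(\tau))E_2(\tau)$. For a polynomial $P$ and an indeterminate $Y$, $\mathcal{L}\bigl(P(j)/(Y-j)\bigr)$ denotes the formal series $\sum_{n\ge0}\mathcal{L}(P(j)j^n)\,Y^{-n-1}$. ${}_2F_1(a,b;c;z)=\sum_{n\ge0}\frac{(a)_n(b)_n}{(c)_n n!}z^n$. Normalizing factors: $N_{0,0}=N_{0,2}=1$; for $m\ge1$, $N_{m,0}=24m\binom{6m}{2m}\binom{12m}{6m}$ and $N_{m,2}=\frac{12m+1}{12m-1}N_{m,0}$; for $m\ge0$, $N_{m,6}=12(2m+1)\binom{6m+3}{2m+1}\binom{12m+6}{6m+3}$ and $N_{m,8}=\frac{12m+7}{12m+5}N_{m,6}$. Define rational functions $a_0(x)=\frac{24(144x^2-41)}{(2x+1)(2x-1)}$, $b_0(x)=\frac{36(12x-11)(12x-7)(12x-5)(12x-1)}{x(x-1)(2x-1)^2}$, $a_2(x)=\frac{24(144x^2-29)}{(2x+1)(2x-1)}$, $b_2(x)=\frac{36(12x-13)(12x-7)(12x-5)(12x+1)}{x(x-1)(2x-1)^2}$, and set $a_{n,0}=a_0(n)$,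 $b_{n,0}=b_0(n)$, $a_{n,2}=a_2(n)$, $b_{n,2}=b_2(n)$, $a_{n,6}=a_0(n+\tfrac12)$, $b_{n,6}=b_0(n+\tfrac12)$, $a_{n,8}=a_2(n+\tfrac12)$, $b_{n,8}=b_2(n+\tfrac12)$. For $r\in\{0,2,6,8\}$ and $W\in\{A,B\}$ the polynomials $W_{n,r}(X)\in\mathbb{Q}[X]$ ($n\ge0$) are determined by $W_{n+1,r}=(X-a_{n,r})W_{n,r}-b_{n,r}W_{n-1,r}$, valid for $n\ge2$ when $r\in\{0,2\}$ and for $n\ge1$ when $r\in\{6,8\}$, with initial values $A_{0,0}=0$, $A_{1,0}=1$, $A_{2,0}=X-824$; $A_{0,2}=1$, $A_{1,2}=X-720$, $A_{2,2}=X^2-1640X+269280$; $A_{0,6}=1$, $A_{1,6}=X-1266$; $A_{0,8}=1$, $A_{1,8}=X-330$; $B_{0,0}=1$, $B_{1,0}=X-1008$, $B_{2,0}=X^2-1832X+497952$; $B_{0,2}=0$, $B_{1,2}=1$, $B_{2,2}=X-920$; $B_{0,6}=1$, $B_{1,6}=X-546$; $B_{0,8}=1$, $B_{1,8}=X-1338$. *)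

theory Defs
  imports "HOL-Computational_Algebra.Computational_Algebra"
begin

text \<open>
  Modular forms are represented by their \<open>q\<close>-expansions, as formal Laurent series over \<open>\<rat>\<close>.
  Objects indexed by a pair \<open>(n, r)\<close> with \<open>r\<close> in \<open>{0, 2, 6, 8}\<close> are split into one function of
  \<open>n\<close> for each \<open>r\<close>.
\<close>

definition sigma :: "nat \<Rightarrow> nat \<Rightarrow> nat" where
  "sigma k n = (\<Sum>d | d dvd n. d ^ k)"

text \<open>
  The test \<open>n = 0\<close> is needed because \<^term>\<open>sigma k 0\<close> is a sum over all natural numbers.
\<close>
definition E2 :: "rat fls" where
  "E2 = fps_to_fls (Abs_fps (\<lambda>n. if n = 0 then 1 else - 24 * of_nat (sigma 1 n)))"

definition E4 :: "rat fls" where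
  "E4 = fps_to_fls (Abs_fps (\<lambda>n. if n = 0 then 1 else 240 * of_nat (sigma 3 n)))"

definition E6 :: "rat fls" where
  "E6 = fps_to_fls (Abs_fps (\<lambda>n. if n = 0 then 1 else - 504 * of_nat (sigma 5 n)))"

definition Delta :: "rat fls" where
  "Delta = (E4 ^ 3 - E6 ^ 2) / 1728"

definition j_inv :: "rat fls" where
  "j_inv = E4 ^ 3 / Delta"

text \<open>
  A polynomial in \<open>j\<close> is given by the underlying element of \<^typ>\<open>rat poly\<close>.
\<close>
definition L_fun :: "rat poly \<Rightarrow> rat" where
  "L_fun P = fls_nth (poly (map_poly fls_const P) j_inv * E2) 0"

text \<open>
  The series \<open>\<L>(P(j) / (Y - j))\<close>, as a formal power series in \<open>1/Y\<close>: the coefficient of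
  \<open>(1/Y) ^ (n + 1)\<close> is \<open>\<L>(P(j) j ^ n)\<close>.
\<close>
definition L_gen :: "rat poly \<Rightarrow> rat fps" where
  "L_gen P = Abs_fps (\<lambda>k. case k of 0 \<Rightarrow> 0 | Suc n \<Rightarrow> L_fun (P * [:0, 1:] ^ n))"

text \<open>
  In \<^typ>\<open>rat poly poly\<close> the outer variable is \<open>X\<close> and the inner one is \<open>j\<close>. So \<open>F(X)\<close> has
  constant polynomials as its coefficients, \<open>F(j)\<close> is a constant, and \<open>X - j\<close> is
  \<^term>\<open>[:- [:0, 1:], 1:] :: rat poly poly\<close>.
\<close>
definition diff_quot :: "rat poly \<Rightarrow> rat poly poly" where
  "diff_quot F = (map_poly (\<lambda>c. [:c:]) F - [:F:]) div [:- [:0, 1:], 1:]"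

lemma diff_quot_exact:
  "diff_quot F * [:- [:0, 1:], 1:] = map_poly (\<lambda>c. [:c:]) F - [:F:]"
proof -
  have "poly (map_poly (\<lambda>c. [:c:]) G) [:0, 1:] = G" for G :: "rat poly"
    by (induction G) (auto simp: map_poly_pCons)
  then have "poly (map_poly (\<lambda>c. [:c:]) F - [:F:]) [:0, 1:] = 0"
    by simp
  then have "[:- [:0, 1:], 1:] dvd map_poly (\<lambda>c. [:c:]) F - [:F:]"
    by (simp only: poly_eq_0_iff_dvd)
  then show ?thesis
    unfolding diff_quot_def by (rule dvd_div_mult_self)
qed

text \<open>
  \<open>\<L>\<close> acting on the variable \<open>j\<close> only, that is, on the coefficients of the powers of \<open>X\<close>.
\<close>
definition L_j :: "rat poly poly \<Rightarrow> rat poly" where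
  "L_j Q = map_poly L_fun Q"

lemma L_fun_0: "L_fun 0 = 0"
  by (simp add: L_fun_def)

lemma coeff_L_j: "coeff (L_j Q) i = L_fun (coeff Q i)"
  by (simp add: L_j_def coeff_map_poly L_fun_0)

text \<open>
  The series \<open>\<^sub>2F\<^sub>1(a, b; c; 1728/Y)\<close> in the variable \<open>1/Y\<close>.
\<close>
definition hyp :: "rat \<Rightarrow> rat \<Rightarrow> rat \<Rightarrow> rat fps" where
  "hyp a b c = fps_hypergeo [a, b] [c] 1728"

definition N0 :: "nat \<Rightarrow> rat" where
  "N0 m = (if m = 0 then 1
           else of_nat (24 * m * ((6 * m) choose (2 * m)) * ((12 * m) choose (6 * m))))"

definition N2 :: "nat \<Rightarrow> rat" where
  "N2 m = (if m = 0 then 1 else (12 * of_nat m + 1) / (12 * of_nat m - 1) * N0 m)"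

definition N6 :: "nat \<Rightarrow> rat" where
  "N6 m = of_nat (12 * (2 * m + 1) * ((6 * m + 3) choose (2 * m + 1))
                  * ((12 * m + 6) choose (6 * m + 3)))"

definition N8 :: "nat \<Rightarrow> rat" where
  "N8 m = (12 * of_nat m + 7) / (12 * of_nat m + 5) * N6 m"

definition ra0 :: "rat \<Rightarrow> rat" where
  "ra0 x = 24 * (144 * x ^ 2 - 41) / ((2 * x + 1) * (2 * x - 1))"

definition rb0 :: "rat \<Rightarrow> rat" where
  "rb0 x = 36 * (12 * x - 11) * (12 * x - 7) * (12 * x - 5) * (12 * x - 1)
           / (x * (x - 1) * (2 * x - 1) ^ 2)"

definition ra2 :: "rat \<Rightarrow> rat" where
  "ra2 x = 24 * (144 * x ^ 2 - 29) / ((2 * x + 1) * (2 * x - 1))"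

definition rb2 :: "rat \<Rightarrow> rat" where
  "rb2 x = 36 * (12 * x - 13) * (12 * x - 7) * (12 * x - 5) * (12 * x + 1)
           / (x * (x - 1) * (2 * x - 1) ^ 2)"

definition a0 :: "nat \<Rightarrow> rat" where "a0 n = ra0 (of_nat n)"
definition b0 :: "nat \<Rightarrow> rat" where "b0 n = rb0 (of_nat n)"
definition a2 :: "nat \<Rightarrow> rat" where "a2 n = ra2 (of_nat n)"
definition b2 :: "nat \<Rightarrow> rat" where "b2 n = rb2 (of_nat n)"
definition a6 :: "nat \<Rightarrow> rat" where "a6 n = ra0 (of_nat n + 1 / 2)"
definition b6 :: "nat \<Rightarrow> rat" where "b6 n = rb0 (of_nat n + 1 / 2)"
definition a8 :: "nat \<Rightarrow> rat" where "a8 n = ra2 (of_nat n + 1 / 2)"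
definition b8 :: "nat \<Rightarrow> rat" where "b8 n = rb2 (of_nat n + 1 / 2)"

text \<open>
  In the recursive equations below, the index written \<open>n\<close> in
  \<open>W\<^bsub>n+1\<^esub> = (X - a\<^bsub>n\<^esub>) W\<^bsub>n\<^esub> - b\<^bsub>n\<^esub> W\<^bsub>n-1\<^esub>\<close> is \<open>n + 2\<close> for \<open>r\<close> in \<open>{0, 2}\<close> and \<open>n + 1\<close> for
  \<open>r\<close> in \<open>{6, 8}\<close>.
\<close>

fun A0 :: "nat \<Rightarrow> rat poly" where
  "A0 0 = 0"
| "A0 (Suc 0) = 1"
| "A0 (Suc (Suc 0)) = [:- 824, 1:]"
| "A0 (Suc (Suc (Suc n))) =
     [:- a0 (n + 2), 1:] * A0 (Suc (Suc n)) - smult (b0 (n + 2)) (A0 (Suc n))"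

fun A2 :: "nat \<Rightarrow> rat poly" where
  "A2 0 = 1"
| "A2 (Suc 0) = [:- 720, 1:]"
| "A2 (Suc (Suc 0)) = [:269280, - 1640, 1:]"
| "A2 (Suc (Suc (Suc n))) =
     [:- a2 (n + 2), 1:] * A2 (Suc (Suc n)) - smult (b2 (n + 2)) (A2 (Suc n))"

fun A6 :: "nat \<Rightarrow> rat poly" where
  "A6 0 = 1"
| "A6 (Suc 0) = [:- 1266, 1:]"
| "A6 (Suc (Suc n)) =
     [:- a6 (n + 1), 1:] * A6 (Suc n) - smult (b6 (n + 1)) (A6 n)"

fun A8 :: "nat \<Rightarrow> rat poly" where
  "A8 0 = 1"
| "A8 (Suc 0) = [:- 330, 1:]"
| "A8 (Suc (Suc n)) =
     [:- a8 (n + 1), 1:] * A8 (Suc n) - smult (b8 (n + 1)) (A8 n)"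

fun B0 :: "nat \<Rightarrow> rat poly" where
  "B0 0 = 1"
| "B0 (Suc 0) = [:- 1008, 1:]"
| "B0 (Suc (Suc 0)) = [:497952, - 1832, 1:]"
| "B0 (Suc (Suc (Suc n))) =
     [:- a0 (n + 2), 1:] * B0 (Suc (Suc n)) - smult (b0 (n + 2)) (B0 (Suc n))"

fun B2 :: "nat \<Rightarrow> rat poly" where
  "B2 0 = 0"
| "B2 (Suc 0) = 1"
| "B2 (Suc (Suc 0)) = [:- 920, 1:]"
| "B2 (Suc (Suc (Suc n))) =
     [:- a2 (n + 2), 1:] * B2 (Suc (Suc n)) - smult (b2 (n + 2)) (B2 (Suc n))"

fun B6 :: "nat \<Rightarrow> rat poly" where
  "B6 0 = 1"
| "B6 (Suc 0) = [:- 546, 1:]"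
| "B6 (Suc (Suc n)) =
     [:- a6 (n + 1), 1:] * B6 (Suc n) - smult (b6 (n + 1)) (B6 n)"

fun B8 :: "nat \<Rightarrow> rat poly" where
  "B8 0 = 1"
| "B8 (Suc 0) = [:- 1338, 1:]"
| "B8 (Suc (Suc n)) =
     [:- a8 (n + 1), 1:] * B8 (Suc n) - smult (b8 (n + 1)) (B8 n)"

text \<open>
  The polynomials \<open>X\<close> and \<open>X - 1728\<close>.
\<close>
abbreviation pX :: "rat poly" where "pX \<equiv> [:0, 1:]"
abbreviation pX1728 :: "rat poly" where "pX1728 \<equiv> [:- 1728, 1:]"

definition delta :: "nat \<Rightarrow> nat \<Rightarrow> rat" where
  "delta m n = (if m = n then 1 else 0)"

end

theory Submission
  imports Defs
begin

text \<open>
  Write \<open>t = 1/j\<close> and \<open>D = q d/dq\<close>. Since \<open>Dt/t = E6/E4\<close>, taking residues in \<open>t\<close> instead of \<open>q\<close> shows that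
  \<open>\<L>(j ^ n)\<close> is the coefficient of \<open>t ^ n\<close> in \<open>E2 E4/E6\<close>. By Ramanujan's differential equations this
  series satisfies a Riccati equation in \<open>t\<close>, whose solution with constant term \<open>1\<close> is the quotient
  \<open>\<^sub>2F\<^sub>1(5/12, 13/12; 1; 1728 t) / \<^sub>2F\<^sub>1(1/12, 5/12; 1; 1728 t)\<close>. Two applications of the contiguous relation
  behind Gauss's continued fraction give a three-term relation for the numerators in (ii), which is
  the recurrence of the polynomials \<open>A\<close>; so (ii) follows by induction from its first two cases.
  The vanishing of the low coefficients in (ii) is orthogonality to lower powers of \<open>j\<close>, hence (iii),
  and (i) holds since both sides satisfy the same recurrence.
  Ramanujan's equations are convolution identities for divisor sums. They come from the involution
  \<open>(a, b, x, y) \<mapsto> (y, x - y, a + b, a)\<close> of the solutions of \<open>a x + b y = n\<close> with \<open>x > y\<close>.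
\<close>

section \<open>Convolution sums\<close>

text \<open>Records divisors \<open>a\<close> of \<open>m\<close> and \<open>b\<close> of
  \<open>n - m\<close>, with complementary divisors \<open>x\<close> and \<open>y\<close>, as they
  occur in a convolution of two divisor sums.\<close>

definition quads :: "nat \<Rightarrow> (nat \<times> nat \<times> nat \<times> nat) set" where
  "quads n = {(a, b, x, y). 0 < a \<and> 0 < b \<and> 0 < x \<and> 0 < y \<and> a * x + b * y = n}"

lemma finite_quads [simp, intro]: "finite (quads n)"
proof (rule finite_subset)
  have "a \<le> n \<and> b \<le> n \<and> x \<le> n \<and> y \<le> n"
    if "0 < a" "0 < b" "0 < x" "0 < y" "a * x + b * y = n" for a b x y
  proof -
    have "a \<le> a * x" "x \<le> a * x" "b \<le> b * y" "y \<le> b * y"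
      using that by auto
    then show ?thesis
      using that(5) by linarith
  qed
  then show "quads n \<subseteq> {..n} \<times> {..n} \<times> {..n} \<times> {..n}"
    by (auto simp: quads_def)
qed auto

lemma sum_quads_swap:
  "(\<Sum>(a, b, x, y)\<in>{(a, b, x, y)\<in>quads n. P a b x y}. g a b x y)
   = (\<Sum>(a, b, x, y)\<in>{(a, b, x, y)\<in>quads n. P b a y x}. g b a y x)"
  by (rule sum.reindex_bij_witness[of _ "\<lambda>(a, b, x, y). (b, a, y, x)" "\<lambda>(a, b, x, y). (b, a, y, x)"])
    (auto simp: quads_def algebra_simps)

lemma sum_quads_transpose:
  "(\<Sum>(a, b, x, y)\<in>quads n. g a b x y) = (\<Sum>(a, b, x, y)\<in>quads n. g x y a b)"
  by (rule sum.reindex_bij_witness[of _ "\<lambda>(a, b, x, y). (x, y, a, b)" "\<lambda>(a, b, x, y). (x, y, a, b)"])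
    (auto simp: quads_def algebra_simps)

text \<open>The map to \<open>(y, x - y, a + b, a)\<close> preserves \<open>y < x\<close> and the
  value \<open>n\<close>, as \<open>y (a + b) + (x - y) a = a x + b y\<close>, and is its own
  inverse. Integer arguments make \<open>x - y\<close> a true difference.\<close>

lemma sum_quads_involution:
  fixes g :: "int \<Rightarrow> int \<Rightarrow> int \<Rightarrow> int \<Rightarrow> rat"
  shows "(\<Sum>(a, b, x, y)\<in>{(a, b, x, y)\<in>quads n. y < x}. g (int a) (int b) (int x) (int y))
    = (\<Sum>(a, b, x, y)\<in>{(a, b, x, y)\<in>quads n. y < x}. g (int y) (int x - int y) (int a + int b) (int a))"
proof -
  have *: "a * y + (a * x + c - a * y) = a * x + c" if "y < x" for a x y c :: nat
    using that by (simp add: trans_le_add1)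
  show ?thesis
    by (intro sum.reindex_bij_witness[of _ "\<lambda>(a, b, x, y). (y, x - y, a + b, a)"
          "\<lambda>(a, b, x, y). (y, x - y, a + b, a)"])
      (auto simp: quads_def algebra_simps of_nat_diff diff_mult_distrib2 *)
qed

text \<open>Exchanging the summands \<open>a x\<close> and \<open>b y\<close> matches the tuples
  with \<open>x < y\<close> to those with \<open>y < x\<close>.\<close>

lemma sum_quads_split:
  fixes g :: "nat \<Rightarrow> nat \<Rightarrow> nat \<Rightarrow> nat \<Rightarrow> rat"
  assumes "\<And>a b x y. g b a y x = g a b x y"
  shows "(\<Sum>(a, b, x, y)\<in>quads n. g a b x y)
    = 2 * (\<Sum>(a, b, x, y)\<in>{(a, b, x, y)\<in>quads n. y < x}. g a b x y)
      + (\<Sum>(a, b, x, y)\<in>{(a, b, x, y)\<in>quads n. x = y}. g a b x y)"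
proof -
  let ?S = "\<lambda>Q. {(a, b, x, y)\<in>quads n. Q x y}"
  let ?g = "\<lambda>(a, b, x, y). g a b x y"
  have fin: "finite (?S Q)" for Q
    by (rule finite_subset[OF _ finite_quads[of n]]) auto
  have "sum ?g (quads n) = sum ?g ((?S (\<lambda>x y. y < x) \<union> ?S (\<lambda>x y. x < y)) \<union> ?S (=))"
    by (rule arg_cong[where f = "sum ?g"]) auto
  also have "\<dots> = (sum ?g (?S (\<lambda>x y. y < x)) + sum ?g (?S (\<lambda>x y. x < y))) + sum ?g (?S (=))"
    by (subst sum.union_disjoint, use fin in auto)+
  also have "sum ?g (?S (\<lambda>x y. x < y)) = sum ?g (?S (\<lambda>x y. y < x))"
    by (subst sum_quads_swap) (simp add: assms)
  finally show ?thesis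
    by simp
qed

text \<open>If \<open>x = y\<close>, then \<open>(a + b) x = n\<close>: here
  \<open>d = a + b\<close> runs over the divisors of \<open>n\<close>, and \<open>a\<close> over
  \<open>1, ..., d - 1\<close>.\<close>

lemma sum_quads_diagonal:
  fixes g :: "nat \<Rightarrow> nat \<Rightarrow> nat \<Rightarrow> rat"
  assumes "0 < n"
  shows "(\<Sum>(a, b, x, y)\<in>{(a, b, x, y)\<in>quads n. x = y}. g a b x)
    = (\<Sum>d | d dvd n. \<Sum>a\<in>{1..<d}. g a (d - a) (n div d))"
proof -
  have "(\<Sum>d | d dvd n. \<Sum>a\<in>{1..<d}. g a (d - a) (n div d))
      = (\<Sum>(d, a)\<in>(SIGMA d:{d. d dvd n}. {1..<d}). g a (d - a) (n div d))"
    using assms by (subst sum.Sigma) auto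
  also have "\<dots> = (\<Sum>(a, b, x, y)\<in>{(a, b, x, y)\<in>quads n. x = y}. g a b x)"
    using assms
    by (intro sum.reindex_bij_witness[of _ "\<lambda>(a, b, x, y). (a + b, a)"
          "\<lambda>(d, a). (a, d - a, n div d, n div d)"])
      (auto simp: quads_def simp flip: add_mult_distrib)
  finally show ?thesis ..
qed

text \<open>Both sums are twice a sum over \<open>y < x\<close> plus a diagonal sum. The involution
  identifies the sums over \<open>y < x\<close>, so only the diagonals remain. Subtracting
  \<open>p a (- b)\<close> leaves twice the part of \<open>p\<close> that is odd in
  \<open>b\<close>.\<close>

lemma convolution_identity:
  fixes p :: "int \<Rightarrow> int \<Rightarrow> rat"
  assumes sym: "\<And>a b. p b a = p a b" and inv: "\<And>a b. p (- a) (a + b) = p a b" and n: "0 < n"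
  shows "(\<Sum>(a, b, x, y)\<in>quads n. p (int a) (int b) - p (int a) (- int b))
    = (\<Sum>d | d dvd n. \<Sum>a\<in>{1..<d}. p (int a) (int d - int a))
      - (\<Sum>d | d dvd n. (of_nat (n div d) - 1) * p (int d) 0)"
proof -
  let ?D = "{(a, b, x, y)\<in>quads n. x = y}" and ?U = "{(a, b, x, y)\<in>quads n. y < x}"
  have q_sym: "p (int x) (int y - int x) = p (int y) (int x - int y)" for x y
    using inv[of "int y - int x" "int x"] by (simp add: sym)
  have q: "p (int b) (int a - int b) = p (int a) (- int b)" for a b
    using inv[of "int b" "int a - int b"] by (simp add: sym)
  \<comment> \<open>After exchanging \<open>(a, b)\<close> with \<open>(x, y)\<close>, invariance
    turns \<open>p x (- y)\<close> into \<open>p y (x - y)\<close>, the form produced by the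
    involution.\<close>
  have "(\<Sum>(a, b, x, y)\<in>quads n. p (int a) (- int b))
      = (\<Sum>(a, b, x, y)\<in>quads n. p (int y) (int x - int y))"
    by (subst sum_quads_transpose) (simp add: q)
  also have "\<dots> = 2 * (\<Sum>(a, b, x, y)\<in>?U. p (int y) (int x - int y))
      + (\<Sum>(a, b, x, y)\<in>?D. p (int y) (int x - int y))"
    by (rule sum_quads_split) (rule q_sym)
  also have "(\<Sum>(a, b, x, y)\<in>?U. p (int y) (int x - int y)) = (\<Sum>(a, b, x, y)\<in>?U. p (int a) (int b))"
    using sum_quads_involution[of "\<lambda>a b x y. p a b" n] by simp
  also have "(\<Sum>(a, b, x, y)\<in>?D. p (int y) (int x - int y)) = (\<Sum>(a, b, x, y)\<in>?D. p (int x) 0)"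
    by (rule sum.cong) auto
  \<comment> \<open>Each \<open>d\<close> has \<open>d - 1\<close> decompositions
    \<open>a + b\<close>; the next step passes to the complementary divisor.\<close>
  also have "\<dots> = (\<Sum>d | d dvd n. (of_nat d - 1) * p (int (n div d)) 0)"
    using n by (subst sum_quads_diagonal) (auto intro!: sum.cong simp: of_nat_diff Suc_le_eq dvd_pos_nat)
  also have "\<dots> = (\<Sum>d | d dvd n. (of_nat (n div d) - 1) * p (int d) 0)"
    by (rule sum.reindex_bij_witness[of _ "\<lambda>d. n div d" "\<lambda>d. n div d"]) (use n in auto)
  finally have 1: "(\<Sum>(a, b, x, y)\<in>quads n. p (int a) (- int b))
    = 2 * (\<Sum>(a, b, x, y)\<in>?U. p (int a) (int b))
      + (\<Sum>d | d dvd n. (of_nat (n div d) - 1) * p (int d) 0)" .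
  have "(\<Sum>(a, b, x, y)\<in>quads n. p (int a) (int b))
    = 2 * (\<Sum>(a, b, x, y)\<in>?U. p (int a) (int b)) + (\<Sum>(a, b, x, y)\<in>?D. p (int a) (int b))"
    by (rule sum_quads_split) (rule sym)
  also have "(\<Sum>(a, b, x, y)\<in>?D. p (int a) (int b))
      = (\<Sum>d | d dvd n. \<Sum>a\<in>{1..<d}. p (int a) (int d - int a))"
    using n by (subst sum_quads_diagonal) (auto intro!: sum.cong simp: of_nat_diff)
  finally show ?thesis
    using 1 by (simp add: sum_subtractf case_prod_unfold)
qed

section \<open>Divisor sums as formal power series\<close>

definition sigma_fps :: "nat \<Rightarrow> rat fps" where
  "sigma_fps k = Abs_fps (\<lambda>n. if n = 0 then 0 else of_nat (sigma k n))"

lemma sigma_fps_nth_0 [simp]: "sigma_fps k $ 0 = 0"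
  by (simp add: sigma_fps_def)

lemma sigma_fps_nth: "0 < n \<Longrightarrow> sigma_fps k $ n = (\<Sum>d | d dvd n. of_nat d ^ k)"
  by (simp add: sigma_fps_def sigma_def)

text \<open>Put \<open>m = a x\<close> and \<open>n - m = b y\<close>; the vanishing constant terms
  leave only \<open>0 < m < n\<close>.\<close>

lemma sigma_fps_mult_nth:
  "(sigma_fps i * sigma_fps j) $ n = (\<Sum>(a, b, x, y)\<in>quads n. of_nat a ^ i * of_nat b ^ j)"
proof -
  let ?T = "SIGMA m:{0<..<n}. {a. a dvd m} \<times> {b. b dvd n - m}"
  have "(sigma_fps i * sigma_fps j) $ n = (\<Sum>m=0..n. sigma_fps i $ m * sigma_fps j $ (n - m))"
    by (rule fps_mult_nth)
  also have "\<dots> = (\<Sum>m\<in>{0<..<n}. sigma_fps i $ m * sigma_fps j $ (n - m))"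
  proof (rule sum.mono_neutral_right)
    show "\<forall>m\<in>{0..n} - {0<..<n}. sigma_fps i $ m * sigma_fps j $ (n - m) = 0"
    proof
      fix m assume "m \<in> {0..n} - {0<..<n}"
      then have "m = 0 \<or> m = n" by auto
      then show "sigma_fps i $ m * sigma_fps j $ (n - m) = 0" by auto
    qed
  qed auto
  also have "\<dots> = (\<Sum>m\<in>{0<..<n}. \<Sum>(a, b)\<in>{a. a dvd m} \<times> {b. b dvd n - m}. of_nat a ^ i * of_nat b ^ j)"
    by (auto intro!: sum.cong simp: sigma_fps_nth sum_product sum.cartesian_product)
  also have "\<dots> = (\<Sum>(m, a, b)\<in>?T. of_nat a ^ i * of_nat b ^ j)"
    by (subst sum.Sigma) auto
  also have "\<dots> = (\<Sum>(a, b, x, y)\<in>quads n. of_nat a ^ i * of_nat b ^ j)"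
    by (rule sum.reindex_bij_witness[of _ "\<lambda>(a, b, x, y). (a * x, a, b)"
          "\<lambda>(m, a, b). (a, b, m div a, (n - m) div b)"])
      (auto simp: quads_def dvd_div_eq_0_iff intro!: Nat.gr0I)
  finally show ?thesis .
qed

section \<open>Ramanujan's differential equations\<close>

text \<open>Faulhaber's formulas up to exponent 6, the degree of \<open>e2 ^ 3\<close>.\<close>

lemma sum_Suc_pow:
  fixes N :: nat
  defines "x \<equiv> of_nat N :: rat"
  shows "(\<Sum>a\<in>{1..<Suc N}. of_nat a) = x * (x + 1) / 2"
    and "(\<Sum>a\<in>{1..<Suc N}. of_nat a ^ 2) = x * (x + 1) * (2 * x + 1) / 6"
    and "(\<Sum>a\<in>{1..<Suc N}. of_nat a ^ 3) = x ^ 2 * (x + 1) ^ 2 / 4"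
    and "(\<Sum>a\<in>{1..<Suc N}. of_nat a ^ 4) = x * (x + 1) * (2 * x + 1) * (3 * x ^ 2 + 3 * x - 1) / 30"
    and "(\<Sum>a\<in>{1..<Suc N}. of_nat a ^ 5) = x ^ 2 * (x + 1) ^ 2 * (2 * x ^ 2 + 2 * x - 1) / 12"
    and "(\<Sum>a\<in>{1..<Suc N}. of_nat a ^ 6)
      = x * (x + 1) * (2 * x + 1) * (3 * x ^ 4 + 6 * x ^ 3 - 3 * x + 1) / 42"
  unfolding x_def by (induction N) (simp_all add: field_simps eval_nat_numeral)

text \<open>
  The polynomials to which \<open>convolution_identity\<close> applies are the even ones that are symmetric in
  \<open>a\<close>, \<open>b\<close>, \<open>- a - b\<close>. They are generated by \<open>e2\<close> and \<open>e3 ^ 2\<close>.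
\<close>
definition e2 :: "int \<Rightarrow> int \<Rightarrow> rat" where
  "e2 a b = of_int (a ^ 2 + a * b + b ^ 2)"

definition e3 :: "int \<Rightarrow> int \<Rightarrow> rat" where
  "e3 a b = of_int (a * b * (a + b))"

lemma e2_invariant: "e2 b a = e2 a b" "e2 (- a) (a + b) = e2 a b"
  by (simp_all add: e2_def algebra_simps power2_eq_square)

lemma e3_invariant: "e3 b a = e3 a b" "e3 (- a) (a + b) ^ 2 = e3 a b ^ 2"
  by (simp_all add: e3_def algebra_simps power2_eq_square)

text \<open>For \<open>a + b = d\<close>, \<open>e2\<close> becomes \<open>a^2 - d a + d^2\<close>
  and \<open>e3\<close> becomes \<open>d a (d - a)\<close>, so Faulhaber's formulas apply. The even
  power of \<open>d\<close> in each of the first three results later cancels against the weighted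
  divisor sum.\<close>

lemma sum_e2_e3:
  fixes d :: nat
  assumes "0 < d"
  defines "D \<equiv> of_nat d :: rat"
  shows "(\<Sum>a\<in>{1..<d}. e2 (int a) (int d - int a)) = 5/6 * D ^ 3 - D ^ 2 + 1/6 * D"
    and "(\<Sum>a\<in>{1..<d}. e2 (int a) (int d - int a) ^ 2)
      = 7/10 * D ^ 5 - D ^ 4 + 1/3 * D ^ 3 - 1/30 * D"
    and "(\<Sum>a\<in>{1..<d}. e2 (int a) (int d - int a) ^ 3)
      = 83/140 * D ^ 7 - D ^ 6 + 1/2 * D ^ 5 - 7/60 * D ^ 3 + 1/42 * D"
    and "(\<Sum>a\<in>{1..<d}. e3 (int a) (int d - int a) ^ 2) = 1/30 * D ^ 7 - 1/30 * D ^ 3"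
proof -
  obtain N where N: "d = Suc N" using assms by (cases d) auto
  have D: "D = of_nat N + 1" by (simp add: D_def N)
  note sums = sum.distrib sum_subtractf sum_distrib_left[symmetric] sum_Suc_pow
  have "(\<Sum>a\<in>{1..<d}. e2 (int a) (int d - int a))
      = (\<Sum>a\<in>{1..<Suc N}. of_nat a ^ 2 - D * of_nat a + D ^ 2)"
    unfolding N by (rule sum.cong[OF refl]) (simp add: e2_def D_def N, algebra)
  also have "\<dots> = 5/6 * D ^ 3 - D ^ 2 + 1/6 * D"
    unfolding sums by (simp add: D field_simps eval_nat_numeral)
  finally show "(\<Sum>a\<in>{1..<d}. e2 (int a) (int d - int a)) = 5/6 * D ^ 3 - D ^ 2 + 1/6 * D" .
  have "(\<Sum>a\<in>{1..<d}. e2 (int a) (int d - int a) ^ 2)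
      = (\<Sum>a\<in>{1..<Suc N}. of_nat a ^ 4 - 2 * D * of_nat a ^ 3
          + 3 * D ^ 2 * of_nat a ^ 2 - 2 * D ^ 3 * of_nat a + D ^ 4)"
    unfolding N by (rule sum.cong[OF refl]) (simp add: e2_def D_def N, algebra)
  also have "\<dots> = 7/10 * D ^ 5 - D ^ 4 + 1/3 * D ^ 3 - 1/30 * D"
    unfolding sums by (simp add: D field_simps eval_nat_numeral)
  finally show "(\<Sum>a\<in>{1..<d}. e2 (int a) (int d - int a) ^ 2)
      = 7/10 * D ^ 5 - D ^ 4 + 1/3 * D ^ 3 - 1/30 * D" .
  have "(\<Sum>a\<in>{1..<d}. e2 (int a) (int d - int a) ^ 3)
      = (\<Sum>a\<in>{1..<Suc N}. of_nat a ^ 6 - 3 * D * of_nat a ^ 5 + 6 * D ^ 2 * of_nat a ^ 4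
          - 7 * D ^ 3 * of_nat a ^ 3 + 6 * D ^ 4 * of_nat a ^ 2 - 3 * D ^ 5 * of_nat a + D ^ 6)"
    unfolding N by (rule sum.cong[OF refl]) (simp add: e2_def D_def N, algebra)
  also have "\<dots> = 83/140 * D ^ 7 - D ^ 6 + 1/2 * D ^ 5 - 7/60 * D ^ 3 + 1/42 * D"
    unfolding sums by (simp add: D field_simps eval_nat_numeral)
  finally show "(\<Sum>a\<in>{1..<d}. e2 (int a) (int d - int a) ^ 3)
      = 83/140 * D ^ 7 - D ^ 6 + 1/2 * D ^ 5 - 7/60 * D ^ 3 + 1/42 * D" .
  have "(\<Sum>a\<in>{1..<d}. e3 (int a) (int d - int a) ^ 2)
      = (\<Sum>a\<in>{1..<Suc N}. D ^ 2 * of_nat a ^ 4 - 2 * D ^ 3 * of_nat a ^ 3 + D ^ 4 * of_nat a ^ 2)"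
    unfolding N by (rule sum.cong[OF refl]) (simp add: e3_def D_def N, algebra)
  also have "\<dots> = 1/30 * D ^ 7 - 1/30 * D ^ 3"
    unfolding sums by (simp add: D field_simps eval_nat_numeral)
  finally show "(\<Sum>a\<in>{1..<d}. e3 (int a) (int d - int a) ^ 2) = 1/30 * D ^ 7 - 1/30 * D ^ 3" .
qed

text \<open>Evaluates the second diagonal sum, since \<open>p d 0\<close> is a power of
  \<open>d\<close> when \<open>p\<close> is a power of \<open>e2\<close>. The factor
  \<open>n\<close> is the source of the derivatives in the convolution identities.\<close>

lemma sum_divisors_weighted:
  assumes "0 < n"
  shows "(\<Sum>d | d dvd n. (of_nat (n div d) - 1) * of_nat d ^ Suc k)
    = of_nat n * sigma_fps k $ n - sigma_fps (Suc k) $ n"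
proof -
  have "(of_nat (n div d) - 1) * of_nat d ^ Suc k = (of_nat n * of_nat d ^ k - of_nat d ^ Suc k :: rat)"
    if "d dvd n" for d
  proof -
    have "of_nat (n div d) * of_nat d = (of_nat n :: rat)"
      using that by (simp flip: of_nat_mult)
    then show ?thesis
      by (simp add: algebra_simps flip: mult.assoc)
  qed
  then show ?thesis
    using assms by (simp add: sigma_fps_nth sum_subtractf sum_distrib_left)
qed

text \<open>The Euler operator: \<open>q d/dq\<close> for series in \<open>q\<close>, and
  \<open>t d/dt\<close> for series in \<open>t = 1/j\<close>.\<close>

definition fps_D :: "rat fps \<Rightarrow> rat fps" where
  "fps_D f = fps_X * fps_deriv f"

lemma fps_D_nth [simp]: "fps_D f $ n = of_nat n * f $ n"
  by (cases n) (simp_all add: fps_D_def)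

lemma fps_D_add [simp]: "fps_D (f + g) = fps_D f + fps_D g"
  by (simp add: fps_D_def algebra_simps)

lemma fps_D_diff [simp]: "fps_D (f - g) = fps_D f - fps_D g"
  by (simp add: fps_D_def algebra_simps)

lemma fps_D_mult [simp]: "fps_D (f * g) = fps_D f * g + f * fps_D g"
  by (simp add: fps_D_def algebra_simps)

lemma fps_D_const [simp]: "fps_D (fps_const c) = 0" "fps_D (numeral k) = 0" "fps_D 1 = 0"
  by (simp_all add: fps_D_def)

text \<open>The invariants \<open>e2\<close>, \<open>e2 ^ 2\<close>, \<open>e2 ^ 3\<close> and
  \<open>e3 ^ 2\<close> give the four identities, in this order. The third mixes two products; the
  fourth separates them.\<close>

lemma sigma_convolutions:
  shows "12 * (sigma_fps 1 * sigma_fps 1) = 5 * sigma_fps 3 + sigma_fps 1 - 6 * fps_D (sigma_fps 1)" (is ?a)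
    and "240 * (sigma_fps 1 * sigma_fps 3)
      = 21 * sigma_fps 5 + 10 * sigma_fps 3 - sigma_fps 1 - 30 * fps_D (sigma_fps 3)" (is ?b)
    and "5040 * (sigma_fps 1 * sigma_fps 5) + 5880 * (sigma_fps 3 * sigma_fps 3)
      = 249 * sigma_fps 7 + 210 * sigma_fps 5 - 49 * sigma_fps 3 + 10 * sigma_fps 1
        - 420 * fps_D (sigma_fps 5)" (is ?c)
    and "120 * (sigma_fps 3 * sigma_fps 3) = sigma_fps 7 - sigma_fps 3" (is ?d)
proof -
  have comm: "sigma_fps i * sigma_fps j = sigma_fps j * sigma_fps i" for i j
    by (rule mult.commute)
  have 1: "2 * (sigma_fps 1 * sigma_fps 1) $ n
      = 5/6 * sigma_fps 3 $ n + 1/6 * sigma_fps 1 $ n - of_nat n * sigma_fps 1 $ n"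
    and 2: "4 * (sigma_fps 3 * sigma_fps 1) $ n + 4 * (sigma_fps 1 * sigma_fps 3) $ n
      = 7/10 * sigma_fps 5 $ n + 1/3 * sigma_fps 3 $ n - 1/30 * sigma_fps 1 $ n
        - of_nat n * sigma_fps 3 $ n"
    and 3: "6 * (sigma_fps 5 * sigma_fps 1) $ n + 14 * (sigma_fps 3 * sigma_fps 3) $ n
        + 6 * (sigma_fps 1 * sigma_fps 5) $ n
      = 83/140 * sigma_fps 7 $ n + 1/2 * sigma_fps 5 $ n - 7/60 * sigma_fps 3 $ n
        + 1/42 * sigma_fps 1 $ n - of_nat n * sigma_fps 5 $ n"
    and 4: "4 * (sigma_fps 3 * sigma_fps 3) $ n = 1/30 * sigma_fps 7 $ n - 1/30 * sigma_fps 3 $ n"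
    if n: "0 < n" for n
  proof -
    note conv = convolution_identity[OF _ _ n]
    have sums: "(\<Sum>d | d dvd n. \<Sum>a\<in>{1..<d}. f d a) = (\<Sum>d | d dvd n. g d)"
      if "\<And>d. 0 < d \<Longrightarrow> (\<Sum>a\<in>{1..<d}. f d a) = g d" for f :: "nat \<Rightarrow> nat \<Rightarrow> rat" and g
      using n that by (intro sum.cong) (auto intro: dvd_pos_nat)
    note simps = sigma_fps_mult_nth sigma_fps_nth[OF n] sum_distrib_left sum.distrib sum_subtractf
    have weighted: "(\<Sum>d | d dvd n. (of_nat (n div d) - 1) * of_nat d ^ Suc k)
        = of_nat n * sigma_fps k $ n - sigma_fps (Suc k) $ n" for k
      by (rule sum_divisors_weighted[OF n])
    have "(\<Sum>(a, b, x, y)\<in>quads n. 2 * (of_nat a ^ 1 * of_nat b ^ 1))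
        = (\<Sum>(a, b, x, y)\<in>quads n. e2 (int a) (int b) - e2 (int a) (- int b))"
      by (rule sum.cong[OF refl]) (auto simp: e2_def)
    also have "\<dots> = (\<Sum>d | d dvd n. 5/6 * of_nat d ^ 3 - of_nat d ^ 2 + 1/6 * of_nat d)
        - (\<Sum>d | d dvd n. (of_nat (n div d) - 1) * of_nat d ^ Suc 1)"
      by (subst conv; simp only: e2_invariant sums[OF sum_e2_e3(1)]) (simp add: e2_def power2_eq_square)
    finally show "2 * (sigma_fps 1 * sigma_fps 1) $ n
      = 5/6 * sigma_fps 3 $ n + 1/6 * sigma_fps 1 $ n - of_nat n * sigma_fps 1 $ n"
      unfolding weighted by (simp add: simps case_prod_unfold eval_nat_numeral)
    have "(\<Sum>(a, b, x, y)\<in>quads n. 4 * (of_nat a ^ 3 * of_nat b ^ 1) + 4 * (of_nat a ^ 1 * of_nat b ^ 3))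
        = (\<Sum>(a, b, x, y)\<in>quads n. e2 (int a) (int b) ^ 2 - e2 (int a) (- int b) ^ 2)"
      by (rule sum.cong[OF refl]) (auto simp: e2_def, algebra)
    also have "\<dots> = (\<Sum>d | d dvd n. 7/10 * of_nat d ^ 5 - of_nat d ^ 4 + 1/3 * of_nat d ^ 3 - 1/30 * of_nat d)
        - (\<Sum>d | d dvd n. (of_nat (n div d) - 1) * of_nat d ^ Suc 3)"
      by (subst conv; simp only: e2_invariant sums[OF sum_e2_e3(2)]) (simp add: e2_def)
    finally show "4 * (sigma_fps 3 * sigma_fps 1) $ n + 4 * (sigma_fps 1 * sigma_fps 3) $ n
      = 7/10 * sigma_fps 5 $ n + 1/3 * sigma_fps 3 $ n - 1/30 * sigma_fps 1 $ n
        - of_nat n * sigma_fps 3 $ n"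
      unfolding weighted by (simp add: simps case_prod_unfold)
    have "(\<Sum>(a, b, x, y)\<in>quads n. 6 * (of_nat a ^ 5 * of_nat b ^ 1) + 14 * (of_nat a ^ 3 * of_nat b ^ 3)
          + 6 * (of_nat a ^ 1 * of_nat b ^ 5))
        = (\<Sum>(a, b, x, y)\<in>quads n. e2 (int a) (int b) ^ 3 - e2 (int a) (- int b) ^ 3)"
      by (rule sum.cong[OF refl]) (auto simp: e2_def, algebra)
    also have "\<dots> = (\<Sum>d | d dvd n. 83/140 * of_nat d ^ 7 - of_nat d ^ 6 + 1/2 * of_nat d ^ 5
          - 7/60 * of_nat d ^ 3 + 1/42 * of_nat d)
        - (\<Sum>d | d dvd n. (of_nat (n div d) - 1) * of_nat d ^ Suc 5)"
      by (subst conv; simp only: e2_invariant sums[OF sum_e2_e3(3)]) (simp add: e2_def)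
    finally show "6 * (sigma_fps 5 * sigma_fps 1) $ n + 14 * (sigma_fps 3 * sigma_fps 3) $ n
        + 6 * (sigma_fps 1 * sigma_fps 5) $ n
      = 83/140 * sigma_fps 7 $ n + 1/2 * sigma_fps 5 $ n - 7/60 * sigma_fps 3 $ n
        + 1/42 * sigma_fps 1 $ n - of_nat n * sigma_fps 5 $ n"
      unfolding weighted by (simp add: simps case_prod_unfold)
    have "(\<Sum>(a, b, x, y)\<in>quads n. 4 * (of_nat a ^ 3 * of_nat b ^ 3))
        = (\<Sum>(a, b, x, y)\<in>quads n. e3 (int a) (int b) ^ 2 - e3 (int a) (- int b) ^ 2)"
      by (rule sum.cong[OF refl]) (auto simp: e3_def, algebra)
    \<comment> \<open>As \<open>e3 d 0 = 0\<close>, the weighted sum vanishes, and the fourth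
      identity has no derivative.\<close>
    also have "\<dots> = (\<Sum>d | d dvd n. 1/30 * of_nat d ^ 7 - 1/30 * of_nat d ^ 3)"
      by (subst conv; simp only: e3_invariant sums[OF sum_e2_e3(4)]) (simp add: e3_def)
    finally show "4 * (sigma_fps 3 * sigma_fps 3) $ n = 1/30 * sigma_fps 7 $ n - 1/30 * sigma_fps 3 $ n"
      by (simp add: simps case_prod_unfold)
  qed
  have eqI: "f = g" if "f $ 0 = g $ 0" "\<And>n. 0 < n \<Longrightarrow> f $ n = g $ n" for f g :: "rat fps"
    using that by (intro fps_ext) (metis gr0I)
  note nth = numeral_fps_const fps_mult_left_const_nth
  show ?a
    by (rule eqI; (drule 1)?; simp add: nth fps_mult_nth_0)
  show ?b
    by (rule eqI; (drule 2)?; simp add: nth fps_mult_nth_0 comm[of 3 1]; simp add: field_simps)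
  show ?c
    by (rule eqI; (drule 3)?; simp add: nth fps_mult_nth_0 comm[of 5 1]; simp add: field_simps)
  show ?d
    by (rule eqI; (drule 4)?; simp add: nth fps_mult_nth_0; simp add: field_simps)
qed

text \<open>Power series versions of the Eisenstein series, on which \<open>fps_D\<close> and
  composition are available.\<close>

definition E2_fps :: "rat fps" where "E2_fps = 1 - 24 * sigma_fps 1"
definition E4_fps :: "rat fps" where "E4_fps = 1 + 240 * sigma_fps 3"
definition E6_fps :: "rat fps" where "E6_fps = 1 - 504 * sigma_fps 5"

lemma fps_to_fls_Eisenstein:
  "E2 = fps_to_fls E2_fps" "E4 = fps_to_fls E4_fps" "E6 = fps_to_fls E6_fps"
  unfolding E2_def E4_def E6_def E2_fps_def E4_fps_def E6_fps_def sigma_fps_def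
  by (rule arg_cong[where f = fps_to_fls],
      simp add: fps_eq_iff numeral_fps_const fps_mult_left_const_nth)+

lemma Eisenstein_nth_0 [simp]: "E2_fps $ 0 = 1" "E4_fps $ 0 = 1" "E6_fps $ 0 = 1"
  by (simp_all add: E2_fps_def E4_fps_def E6_fps_def)

text \<open>Expanded in divisor sums, these are linear combinations of the convolution
  identities.\<close>

lemma Ramanujan_identities:
  "12 * fps_D E2_fps = E2_fps ^ 2 - E4_fps"
  "3 * fps_D E4_fps = E2_fps * E4_fps - E6_fps"
  "2 * fps_D E6_fps = E2_fps * E6_fps - E4_fps ^ 2"
proof -
  note S = sigma_convolutions
  show "12 * fps_D E2_fps = E2_fps ^ 2 - E4_fps"
    unfolding E2_fps_def E4_fps_def using S(1) by simp algebra
  have "10 * (3 * fps_D E4_fps) = 10 * (E2_fps * E4_fps - E6_fps)"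
    unfolding E2_fps_def E4_fps_def E6_fps_def using S(2) by simp algebra
  then show "3 * fps_D E4_fps = E2_fps * E4_fps - E6_fps"
    by (simp only: mult_cancel_left) simp
  \<comment> \<open>The scaling makes the combination integral; the fourth convolution identity
    eliminates \<open>sigma_fps 7\<close> from the third.\<close>
  have "420 * (2 * fps_D E6_fps) = 420 * (E2_fps * E6_fps - E4_fps ^ 2)"
    unfolding E2_fps_def E4_fps_def E6_fps_def using S(3,4) by simp algebra
  then show "2 * fps_D E6_fps = E2_fps * E6_fps - E4_fps ^ 2"
    by (simp only: mult_cancel_left) simp
qed

section \<open>The Riccati equation\<close>

lemma hyp_nth:
  "hyp a b c $ n = pochhammer a n * pochhammer b n * 1728 ^ n / (pochhammer c n * fact n)"
  by (simp add: hyp_def)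

definition phi :: "rat fps" where "phi = hyp (1/12) (5/12) 1"
definition psi :: "rat fps" where "psi = hyp (5/12) (13/12) 1"

lemma phi_psi_nth_0 [simp]: "phi $ 0 = 1" "psi $ 0 = 1"
  by (simp_all add: phi_def psi_def hyp_nth)

text \<open>Comes from \<open>(13/12)_n = (1/12)_n (1 + 12 n)\<close>.\<close>

lemma psi_eq: "psi = phi + 12 * fps_D phi"
proof (rule fps_ext)
  fix n
  have "pochhammer (13/12) n * (1/12) = pochhammer (1/12) n * (1/12 + of_nat n :: rat)"
    using pochhammer_rec[of "1/12 :: rat" n] pochhammer_rec'[of "1/12 :: rat" n]
    by (simp add: mult.commute)
  then have "pochhammer (13/12) n = pochhammer (1/12) n * (1 + 12 * of_nat n :: rat)"
    by (simp add: field_simps)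
  then show "psi $ n = (phi + 12 * fps_D phi) $ n"
    by (simp add: psi_def phi_def hyp_nth numeral_fps_const fps_mult_left_const_nth
        algebra_simps add_divide_distrib)
qed

text \<open>The hypergeometric equation \<open>D^2 phi = 1728 t (D + 1/12) (D + 5/12) phi\<close>,
  times 144.\<close>

lemma phi_ODE:
  "144 * fps_D (fps_D phi) = 1728 * fps_X * (144 * fps_D (fps_D phi) + 72 * fps_D phi + 5 * phi)"
proof (rule fps_ext)
  fix n
  show "(144 * fps_D (fps_D phi)) $ n
    = (1728 * fps_X * (144 * fps_D (fps_D phi) + 72 * fps_D phi + 5 * phi)) $ n"
  proof (cases n)
    case (Suc m)
    have "phi $ Suc m * (of_nat m + 1) ^ 2 = 1728 * (of_nat m + 1/12) * (of_nat m + 5/12) * phi $ m"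
      unfolding phi_def hyp_nth
      by (simp add: pochhammer_Suc pochhammer_fact[symmetric] divide_simps) (simp add: algebra_simps power2_eq_square)
    then show ?thesis
      by (simp add: Suc numeral_fps_const mult.assoc fps_mult_left_const_nth) (simp add: field_simps power2_eq_square)
  qed (simp add: numeral_fps_const)
qed

definition riccati_H :: "rat fps" where "riccati_H = psi * inverse phi"

lemma riccati_H_mult: "riccati_H * phi = psi"
  by (simp add: riccati_H_def mult.assoc inverse_mult_eq_1)

lemma riccati_H_nth_0 [simp]: "riccati_H $ 0 = 1"
  using arg_cong[OF riccati_H_mult, of "\<lambda>f. f $ 0"] by (simp del: fps_mult_nth_0 add: fps_mult_nth_0)

text \<open>As \<open>riccati_H = 1 + 12 (D phi) / phi\<close> is essentially a logarithmic
  derivative, the second-order linear equation of \<open>phi\<close> becomes a quadratic one of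
  first order.\<close>

lemma riccati_H_ODE:
  "12 * (1 - 1728 * fps_X) * fps_D riccati_H
    = - (1 - 1728 * fps_X) * (riccati_H ^ 2 + 4 * riccati_H) + 6 * riccati_H - 1"
proof -
  have H: "riccati_H * phi = phi + 12 * fps_D phi"
    by (simp add: riccati_H_mult psi_eq)
  have DH: "fps_D riccati_H * phi + riccati_H * fps_D phi = fps_D phi + 12 * fps_D (fps_D phi)"
    using arg_cong[OF H, of fps_D] by simp
  have "phi * phi * (12 * (1 - 1728 * fps_X) * fps_D riccati_H)
    = phi * phi * (- (1 - 1728 * fps_X) * (riccati_H ^ 2 + 4 * riccati_H) + 6 * riccati_H - 1)"
    using H DH phi_ODE by algebra
  moreover have "phi \<noteq> 0"
    using phi_psi_nth_0(1) by fastforce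
  ultimately show ?thesis
    by simp
qed

section \<open>The series \<open>t = 1/j\<close> in \<open>q\<close>\<close>

definition j_recip :: "rat fps" where
  "j_recip = fps_const (1/1728) * (E4_fps ^ 3 - E6_fps ^ 2) * inverse E4_fps ^ 3"

lemma Eisenstein_inverse: "E4_fps * inverse E4_fps = 1" "E6_fps * inverse E6_fps = 1"
  by (simp_all add: inverse_mult_eq_1')

lemma j_recip_eq: "1728 * j_recip * E4_fps ^ 3 = E4_fps ^ 3 - E6_fps ^ 2"
proof -
  have "1728 * fps_const (1/1728 :: rat) = 1"
    by (simp add: numeral_fps_const)
  then show ?thesis
    unfolding j_recip_def using Eisenstein_inverse(1) by algebra
qed

lemma E4_fps_nonzero: "E4_fps \<noteq> 0" "E6_fps \<noteq> 0"
  using Eisenstein_nth_0 by fastforce+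

lemma j_recip_nth_0 [simp]: "j_recip $ 0 = 0"
  by (simp add: j_recip_def fps_mult_nth_0 fps_power_zeroth)

lemma sigma_fps_nth_1: "sigma_fps k $ 1 = 1"
  by (simp add: sigma_fps_nth)

lemma Delta_fps_nonzero: "E4_fps ^ 3 - E6_fps ^ 2 \<noteq> 0"
proof -
  have "(E4_fps ^ 3 - E6_fps ^ 2) $ 1 = 1728"
    by (simp add: E4_fps_def E6_fps_def power3_eq_cube power2_eq_square fps_mult_nth_1
        sigma_fps_nth_1 numeral_fps_const fps_mult_left_const_nth del: One_nat_def)
  then show ?thesis by auto
qed

lemma j_recip_nonzero: "j_recip \<noteq> 0"
  using j_recip_eq Delta_fps_nonzero by auto

text \<open>Differentiate \<open>j_recip_eq\<close> and insert Ramanujan's equations; the terms with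
  \<open>E2\<close> cancel.\<close>

lemma D_j_recip: "fps_D j_recip * E4_fps = j_recip * E6_fps"
proof -
  have "fps_D (1728 * j_recip * (E4_fps * E4_fps * E4_fps)) = fps_D (E4_fps * E4_fps * E4_fps - E6_fps * E6_fps)"
    using j_recip_eq by (simp add: power3_eq_cube power2_eq_square)
  then have "12 * 1728 * E4_fps ^ 2 * (fps_D j_recip * E4_fps) = 12 * 1728 * E4_fps ^ 2 * (j_recip * E6_fps)"
    using j_recip_eq Ramanujan_identities unfolding fps_D_mult fps_D_diff fps_D_const by algebra
  then show ?thesis
    using E4_fps_nonzero by simp
qed

text \<open>Since \<open>K\<close> has no constant term, the equation expresses \<open>n f_n\<close>
  through \<open>f_i\<close> with \<open>i < n\<close>.\<close>

lemma linear_ODE_unique: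
  assumes "fps_D f = f * K" "f $ 0 = 0" "K $ 0 = 0"
  shows "f = 0"
proof (rule fps_ext)
  fix n show "f $ n = 0 $ n"
  proof (induction n rule: less_induct)
    case (less n)
    have "of_nat n * f $ n = (\<Sum>i=0..n. f $ i * K $ (n - i))"
      using assms(1) by (metis fps_D_nth fps_mult_nth)
    also have "\<dots> = 0"
      using less assms(3) by (intro sum.neutral) (metis atLeastAtMost_iff cancel_comm_monoid_add_class.diff_cancel fps_zero_nth le_neq_implies_less mult_eq_0_iff)
    finally show ?case
      using assms(2) by (cases n) auto
  qed
qed

text \<open>Both \<open>riccati_H\<close> at \<open>t = 1/j\<close> and \<open>E2 E4 / E6\<close>
  solve the same Riccati equation in \<open>q\<close> with constant term 1. Their difference solves
  a homogeneous linear equation and so vanishes.\<close>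

lemma riccati_H_compose: "(riccati_H oo j_recip) * E6_fps = E2_fps * E4_fps"
proof -
  let ?t = j_recip and ?P = E2_fps and ?Q = E4_fps and ?R = E6_fps
  let ?Qi = "inverse E4_fps" and ?Ri = "inverse E6_fps"
  define v where "v = riccati_H oo ?t"
  define h where "h = fps_D riccati_H oo ?t"
  define u where "u = ?P * ?Q * ?Ri"
  \<comment> \<open>This is \<open>1 / (1 - 1728 t)\<close>.\<close>
  define w where "w = ?Q ^ 3 * ?Ri ^ 2"
  note hom = fps_compose_mult_distrib fps_compose_power[symmetric] fps_compose_add_distrib fps_compose_sub_distrib fps_compose_uminus
  have num: "numeral k oo ?t = numeral k" for k
    by (simp add: numeral_fps_const)
  have "(12 * (1 - 1728 * fps_X) * fps_D riccati_H) oo ?t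
    = (- (1 - 1728 * fps_X) * (riccati_H ^ 2 + 4 * riccati_H) + 6 * riccati_H - 1) oo ?t"
    by (simp only: riccati_H_ODE)
  then have "12 * (1 - 1728 * ?t) * h = - (1 - 1728 * ?t) * (v ^ 2 + 4 * v) + 6 * v - 1"
    by (simp add: hom num v_def h_def)
  moreover have w: "(1 - 1728 * ?t) * w = 1"
    using j_recip_eq Eisenstein_inverse unfolding w_def by algebra
  ultimately have h: "12 * h = - (v ^ 2 + 4 * v) + 6 * w * v - w"
    by algebra
  have "fps_D v = fps_X * ((fps_deriv riccati_H oo ?t) * fps_deriv ?t)"
    by (simp add: fps_D_def v_def fps_compose_deriv)
  moreover have "h = ?t * (fps_deriv riccati_H oo ?t)"
    by (simp add: h_def fps_D_def hom)
  \<comment> \<open>Chain rule: \<open>Dv = h (Dt / t)\<close>, and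
    \<open>Dt / t = E6 / E4\<close>.\<close>
  ultimately have Dv: "?Q * fps_D v = h * ?R"
    using D_j_recip unfolding fps_D_def by algebra
  have DRi: "?R * fps_D ?Ri = - (fps_D ?R * ?Ri)"
    using arg_cong[OF Eisenstein_inverse(2), of fps_D] by (simp add: add_eq_0_iff)
  have "fps_D u = fps_D ?P * ?Q * ?Ri + ?P * fps_D ?Q * ?Ri + ?P * ?Q * fps_D ?Ri"
    by (simp add: u_def algebra_simps)
  then have Du: "12 * ?Q * fps_D u = (- (u ^ 2 + 4 * u) + 6 * w * u - w) * ?R"
    using DRi Ramanujan_identities Eisenstein_inverse(2) unfolding u_def w_def by algebra
  have "12 * ?Q * fps_D (v - u) = ?R * (v - u) * (- (u + v) - 4 + 6 * w)"
    unfolding fps_D_diff using Dv Du h by algebra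
  moreover have "12 * fps_const (1/12 :: rat) = 1"
    by (simp add: numeral_fps_const)
  ultimately have "fps_D (v - u) = (v - u) * (fps_const (1/12) * ?Qi * ?R * (- (u + v) - 4 + 6 * w))"
    using Eisenstein_inverse(1) by algebra
  \<comment> \<open>The coefficient has constant term \<open>-(1 + 1) - 4 + 6 = 0\<close>, as
    \<open>u\<close>, \<open>v\<close> and \<open>w\<close> have constant term 1.\<close>
  then have "v - u = 0"
    by (rule linear_ODE_unique) (simp_all add: v_def u_def w_def fps_power_zeroth)
  then show ?thesis
    using Eisenstein_inverse(2) unfolding v_def u_def by algebra
qed

section \<open>Moments of the functional\<close>

text \<open>A change of variable in a residue: with \<open>J = 1/T\<close>, the left side is the
  residue of \<open>G(T) / T^(n+1)\<close> with respect to \<open>T\<close>. The condition on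
  \<open>U\<close> says that \<open>T\<close> has a simple zero.\<close>

lemma fls_nth_Lagrange:
  fixes T :: "rat fps" and J :: "rat fls"
  assumes J: "J * fps_to_fls T = 1" and T0: "T $ 0 = 0" and U: "fps_D T = T * U" "U $ 0 = 1"
  shows "fls_nth (J ^ Suc n * fps_to_fls ((G oo T) * fps_D T)) 0 = G $ n"
proof (induction n arbitrary: G)
  \<comment> \<open>Up to the factor \<open>-1/(m + 1)\<close> the series is \<open>q d/dq\<close>
    of \<open>J ^ Suc m\<close>, so its constant term is zero.\<close>
  have vanish: "fls_nth (J ^ (m + 2) * fps_to_fls (fps_D T)) 0 = 0" for m
  proof -
    have DT: "fps_to_fls (fps_D T) = fls_X * fls_deriv (fps_to_fls T)"
      by (simp add: fps_D_def fls_times_fps_to_fls fls_deriv_fps_to_fls)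
    have "J * fls_deriv (fps_to_fls T) + fls_deriv J * fps_to_fls T = 0"
      using arg_cong[OF J, of fls_deriv] by simp
    then have "J ^ 2 * fls_deriv (fps_to_fls T) = - fls_deriv J"
      using J by algebra
    then have "of_nat (Suc m) * J ^ m * fls_X * (J ^ 2 * fls_deriv (fps_to_fls T))
        = of_nat (Suc m) * J ^ m * fls_X * - fls_deriv J"
      by simp
    then have "of_nat (Suc m) * (J ^ (m + 2) * fps_to_fls (fps_D T)) = - (fls_X * fls_deriv (J ^ Suc m))"
      unfolding DT fls_deriv_power power_add diff_Suc_1
      by (simp only: mult_ac mult_minus_left mult_minus_right)
    then have "fls_nth (of_nat (Suc m) * (J ^ (m + 2) * fps_to_fls (fps_D T))) 0 = 0"
      by (simp add: fls_times_both_shifted_simp fls_X_times_conv_shift del: fls_deriv_power of_nat_Suc power_Suc)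
    then show ?thesis
      by (simp add: fls_of_nat del: of_nat_Suc)
  qed
  \<comment> \<open>Splitting off the constant term of \<open>G\<close> leaves a factor
    \<open>T\<close>, which lowers the exponent of \<open>J\<close> by one.\<close>
  have step: "fps_to_fls ((G oo T) * fps_D T) = fls_const (G $ 0) * fps_to_fls (fps_D T)
      + fps_to_fls T * fps_to_fls ((fps_shift 1 G oo T) * fps_D T)" for G
  proof -
    have "G = fps_const (G $ 0) + fps_X * fps_shift 1 G"
      by (rule fps_ext) (auto simp: fps_X_mult_nth split: nat.splits)
    then have "G oo T = fps_const (G $ 0) + T * (fps_shift 1 G oo T)"
      using T0 by (metis fps_compose_add_distrib fps_compose_mult_distrib fps_const_compose fps_X_fps_compose_startby0)
    then show ?thesis
      by (simp add: fls_times_fps_to_fls algebra_simps)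
  qed
  have cancel: "(j * (j * K)) * (c * D + t * S) = c * (K * (j * j) * D) + (j * K) * S"
    if "j * t = 1" for j K c D t S :: "rat fls"
    using that by algebra
  {
    case 0
    have "J * fps_to_fls (fps_D T) = fps_to_fls U"
      using J by (simp add: U(1) fls_times_fps_to_fls flip: mult.assoc)
    moreover have "J * fps_to_fls ((G oo T) * fps_D T) = fls_const (G $ 0) * (J * fps_to_fls (fps_D T))
       + fps_to_fls ((fps_shift 1 G oo T) * fps_D T)"
      unfolding step[of G] using J by algebra
    ultimately show ?case
      using U(2) by simp
  next
    case (Suc n)
    have "J ^ Suc (Suc n) * fps_to_fls ((G oo T) * fps_D T)
      = fls_const (G $ 0) * (J ^ (n + 2) * fps_to_fls (fps_D T))
       + J ^ Suc n * fps_to_fls ((fps_shift 1 G oo T) * fps_D T)"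
      unfolding step[of G] using cancel[OF J] by (simp add: power_add power2_eq_square)
    then show ?case
      using Suc.IH[of "fps_shift 1 G"] vanish[of n] by simp
  }
qed

lemma j_inv_j_recip: "j_inv * fps_to_fls j_recip = 1"
proof -
  have "fps_to_fls (1728 * j_recip * E4_fps ^ 3) = fps_to_fls (E4_fps ^ 3 - E6_fps ^ 2)"
    by (simp only: j_recip_eq)
  then have Delta: "Delta = fps_to_fls j_recip * E4 ^ 3"
    by (simp add: Delta_def fps_to_fls_Eisenstein fls_times_fps_to_fls fps_to_fls_power field_simps)
  have "fps_to_fls j_recip \<noteq> 0" "E4 \<noteq> 0"
    using j_recip_nonzero E4_fps_nonzero by (simp_all add: fps_to_fls_Eisenstein)
  then show ?thesis
    unfolding j_inv_def Delta by simp
qed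

text \<open>With \<open>t = 1/j\<close>, the composition formula and \<open>Dt / t = E6 / E4\<close>
  give \<open>riccati_H(t) Dt = t E2\<close>, so \<open>j^n E2 = j^(n+1) riccati_H(t) Dt\<close>, to
  which the residue formula applies.\<close>

lemma L_fun_pX_power: "L_fun (pX ^ n) = riccati_H $ n"
proof -
  have "pX ^ n = monom 1 n"
    by (simp add: monom_altdef)
  then have map_X: "poly (map_poly fls_const (pX ^ n)) j_inv = j_inv ^ n"
    by (simp add: map_poly_monom poly_monom)
  have *: "fps_D j_recip = j_recip * (E6_fps * inverse E4_fps)"
    using D_j_recip Eisenstein_inverse(1) by algebra
  have "(riccati_H oo j_recip) * fps_D j_recip = j_recip * E2_fps"
    unfolding * using riccati_H_compose Eisenstein_inverse(1) by algebra
  then have "j_inv ^ Suc n * fps_to_fls ((riccati_H oo j_recip) * fps_D j_recip)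
      = (j_inv * fps_to_fls j_recip) * (j_inv ^ n * E2)"
    by (simp add: fls_times_fps_to_fls fps_to_fls_Eisenstein mult_ac)
  then show ?thesis
    using fls_nth_Lagrange[OF j_inv_j_recip j_recip_nth_0 *, of n riccati_H]
    by (simp add: L_fun_def map_X j_inv_j_recip del: power_Suc)
qed

section \<open>Linearity of the functional and its generating series\<close>

lemma L_fun_add: "L_fun (P + Q) = L_fun P + L_fun Q"
proof -
  have "map_poly fls_const (P + Q) = map_poly fls_const P + map_poly fls_const Q"
    by (rule poly_eqI) (simp add: coeff_map_poly fls_plus_const)
  then show ?thesis
    by (simp add: L_fun_def algebra_simps)
qed

lemma L_fun_smult: "L_fun (smult c P) = c * L_fun P"
proof -
  have "map_poly fls_const (smult c P) = smult (fls_const c) (map_poly fls_const P)"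
    by (rule poly_eqI) (simp add: coeff_map_poly)
  then show ?thesis
    by (simp add: L_fun_def mult.assoc)
qed

lemma L_fun_uminus: "L_fun (- P) = - L_fun P"
  using L_fun_smult[of "-1" P] by simp

lemma L_fun_diff: "L_fun (P - Q) = L_fun P - L_fun Q"
  using L_fun_add[of P "- Q"] by (simp add: L_fun_uminus)

lemma L_fun_sum: "L_fun (sum f A) = (\<Sum>i\<in>A. L_fun (f i))"
  by (induction A rule: infinite_finite_induct) (simp_all add: L_fun_0 L_fun_add)

lemma L_gen_nth_0 [simp]: "L_gen P $ 0 = 0"
  by (simp add: L_gen_def)

lemma L_gen_nth_Suc [simp]: "L_gen P $ Suc n = L_fun (P * pX ^ n)"
  by (simp add: L_gen_def)

lemma L_gen_diff: "L_gen (P - Q) = L_gen P - L_gen Q"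
  by (rule fps_ext) (auto simp: L_gen_def L_fun_diff algebra_simps split: nat.splits)

lemma L_gen_smult: "L_gen (smult c P) = fps_const c * L_gen P"
  by (rule fps_ext) (auto simp: L_gen_def L_fun_smult algebra_simps split: nat.splits)

text \<open>The formal version of \<open>j / (Y - j) = Y / (Y - j) - 1\<close>, divided by
  \<open>Y\<close>.\<close>

lemma L_gen_mult_pX: "fps_X * L_gen (pX * P) = L_gen P - fps_const (L_fun P) * fps_X"
proof (rule fps_ext)
  fix n
  show "(fps_X * L_gen (pX * P)) $ n = (L_gen P - fps_const (L_fun P) * fps_X) $ n"
  proof (cases n)
    case (Suc m)
    then show ?thesis
      by (cases m) (simp_all add: fps_X_mult_nth mult.assoc mult.left_commute)
  qed simp
qed

lemma L_gen_1: "L_gen 1 = fps_X * riccati_H"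
  by (rule fps_ext) (auto simp: L_gen_def L_fun_pX_power fps_X_mult_nth split: nat.splits)

section \<open>Contiguous relations\<close>

lemma hyp_commute: "hyp a b c = hyp b a c"
  by (rule fps_ext) (simp add: hyp_nth mult_ac)

lemma hyp_nth_0 [simp]: "hyp a b c $ 0 = 1"
  by (simp add: hyp_nth)

text \<open>Gauss's contiguous relation at the argument \<open>1728 t\<close>, checked
  coefficientwise.\<close>

lemma hyp_contiguous:
  assumes "0 < c"
  shows "hyp a b c = hyp a (b + 1) (c + 1)
    - fps_const (1728 * a * (c - b) / (c * (c + 1))) * fps_X * hyp (a + 1) (b + 1) (c + 2)"
proof (rule fps_ext)
  fix n
  show "hyp a b c $ n = (hyp a (b + 1) (c + 1)
    - fps_const (1728 * a * (c - b) / (c * (c + 1))) * fps_X * hyp (a + 1) (b + 1) (c + 2)) $ n"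
  proof (cases n)
    case (Suc m)
    define k :: rat where "k = of_nat m"
    \<comment> \<open>All Pochhammer symbols at hand are rational multiples of these three.\<close>
    define u v w where "u = pochhammer (a + 1) m" "v = pochhammer (b + 1) m" "w = pochhammer (c + 2) m"
    have pos: "0 \<le> k" "0 < w" "0 < (fact m :: rat)"
      using assms by (auto simp: k_def u_v_w_def pochhammer_pos)
    have 1: "pochhammer a (Suc m) = a * u" "pochhammer b (Suc m) = b * v"
      "pochhammer (c + 1) (Suc m) = (c + 1) * w"
      by (simp_all add: u_v_w_def pochhammer_rec add.assoc)
    have 3: "pochhammer (b + 1) (Suc m) = v * (b + 1 + k)"
      by (simp add: u_v_w_def k_def pochhammer_Suc)
    have "pochhammer c (Suc m) * (c + 1 + k) = c * (c + 1) * w"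
      using pochhammer_rec[of c "Suc m"] pochhammer_rec[of "c + 1" m] pochhammer_Suc[of c "Suc m"]
      by (simp add: u_v_w_def k_def add.commute add.left_commute mult.assoc)
    then have 2: "pochhammer c (Suc m) = c * (c + 1) * w / (c + 1 + k)"
      using assms pos by (simp add: field_simps)
    have "(fact (Suc m) :: rat) = (k + 1) * fact m"
      by (simp add: k_def add.commute)
    then show ?thesis
      using assms pos
      by (simp only: Suc fps_sub_nth mult.assoc fps_mult_left_const_nth fps_X_mult_nth hyp_nth 1 2 3
          nat.distinct if_False diff_Suc_1 flip: u_v_w_def)
        (simp add: divide_simps, simp add: algebra_simps)
  qed simp
qed

text \<open>Three consecutive Gauss relations, with the numerator parameters alternating, eliminate
  the two intermediate series.\<close>

lemma hyp_three_term:
  fixes a b c :: rat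
  assumes "0 < c"
  defines "k1 \<equiv> 1728 * a * (c - b) / (c * (c + 1))"
    and "k2 \<equiv> 1728 * (b + 1) * (c + 1 - a) / ((c + 1) * (c + 2))"
    and "k3 \<equiv> 1728 * (a + 1) * (c + 1 - b) / ((c + 2) * (c + 3))"
  shows "hyp (a + 1) (b + 1) (c + 2) - hyp a b c
    = fps_X * (fps_const (k1 + k2) * hyp (a + 1) (b + 1) (c + 2)
        + fps_const (k2 * k3) * fps_X * hyp (a + 2) (b + 2) (c + 4))"
proof -
  let ?F = "hyp (a + 1) (b + 1) (c + 2)" and ?G = "hyp (a + 1) (b + 2) (c + 3)"
  have 1: "hyp a b c = hyp a (b + 1) (c + 1) - fps_const k1 * fps_X * ?F"
    using hyp_contiguous[OF assms(1), of a b] by (simp add: k1_def)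
  have 2: "hyp a (b + 1) (c + 1) = ?F - fps_const k2 * fps_X * ?G"
    using hyp_contiguous[of "c + 1" "b + 1" a] assms(1)
    by (simp add: k2_def hyp_commute[of _ a] hyp_commute[of _ "a + 1"] add.assoc)
  have 3: "?F = ?G - fps_const k3 * fps_X * hyp (a + 2) (b + 2) (c + 4)"
    using hyp_contiguous[of "c + 2" "a + 1" "b + 1"] assms(1)
    by (simp add: k3_def add.assoc diff_add_eq)
  have "fps_const (k1 + k2) = fps_const k1 + fps_const k2" "fps_const (k2 * k3) = fps_const k2 * fps_const k3"
    by simp_all
  then show ?thesis
    using 1 2 3 by algebra
qed

lemma pochhammer_plus_1: "pochhammer (a + 1) n * a = pochhammer a n * (a + of_nat n)" for a :: rat
  using pochhammer_rec[of a n] pochhammer_rec'[of a n] by (simp add: mult.commute)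

lemma hyp_nth_numerator:
  assumes "0 < a"
  shows "hyp (a + 1) b c $ n = hyp a b c $ n * (a + of_nat n) / a"
    and "hyp b (a + 1) c $ n = hyp b a c $ n * (a + of_nat n) / a"
proof -
  have "pochhammer (a + 1) n = pochhammer a n * (a + of_nat n) / a"
    using pochhammer_plus_1[of a n] assms by (simp add: field_simps)
  then show "hyp (a + 1) b c $ n = hyp a b c $ n * (a + of_nat n) / a"
    and "hyp b (a + 1) c $ n = hyp b a c $ n * (a + of_nat n) / a"
    by (simp_all add: hyp_nth mult_ac)
qed

lemma hyp_nth_denominator:
  assumes "0 < c"
  shows "hyp a b (c + 1) $ n = hyp a b c $ n * c / (c + of_nat n)"
proof -
  have "0 < c + of_nat n"
    using assms by (simp add: add_pos_nonneg)
  then have "pochhammer (c + 1) n = pochhammer c n * (c + of_nat n) / c"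
    using pochhammer_plus_1[of c n] assms by (simp add: field_simps)
  then show ?thesis
    using assms by (simp add: hyp_nth mult_ac)
qed

lemma phi_nth_Suc:
  "phi $ Suc n = phi $ n * (12 * (12 * of_nat n + 1) * (12 * of_nat n + 5)) / (of_nat n + 1) ^ 2"
  by (simp add: phi_def hyp_nth pochhammer_Suc pochhammer_fact[symmetric] divide_simps)
    (simp add: algebra_simps power2_eq_square)

text \<open>Raising a parameter by one multiplies the coefficient by a rational function of
  \<open>n\<close>. Passing through a chain of such steps refers all series of the initial cases to
  \<open>phi\<close>.\<close>

lemma hyp_nth_phi:
  fixes n :: nat
  defines "x \<equiv> of_nat n :: rat"
  shows "psi $ n = phi $ n * (12 * x + 1)"
    and "hyp (5/12) (13/12) 2 $ n = phi $ n * (12 * x + 1) / (x + 1)"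
    and "hyp (13/12) (17/12) 2 $ n = phi $ n * (12 * x + 1) * (12 * x + 5) / (5 * (x + 1))"
    and "hyp (13/12) (17/12) 3 $ n = phi $ n * (12 * x + 1) * (12 * x + 5) * 2 / (5 * (x + 1) * (x + 2))"
    and "hyp (17/12) (25/12) 3 $ n
      = phi $ n * (12 * x + 1) * (12 * x + 5) * (12 * x + 13) * 2 / (65 * (x + 1) * (x + 2))"
    and "hyp (17/12) (25/12) 4 $ n
      = phi $ n * (12 * x + 1) * (12 * x + 5) * (12 * x + 13) * 6 / (65 * (x + 1) * (x + 2) * (x + 3))"
    and "hyp (25/12) (29/12) 4 $ n = phi $ n * (12 * x + 1) * (12 * x + 5) * (12 * x + 13) * (12 * x + 17) * 6
      / (1105 * (x + 1) * (x + 2) * (x + 3))"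
proof -
  have x: "0 \<le> x" by (simp add: x_def)
  note num = hyp_nth_numerator[of "1/12" _ _ n] hyp_nth_numerator[of "5/12" _ _ n]
    hyp_nth_numerator[of "13/12" _ _ n] hyp_nth_numerator[of "17/12" _ _ n]
  note den = hyp_nth_denominator[of 1 _ _ n] hyp_nth_denominator[of 2 _ _ n] hyp_nth_denominator[of 3 _ _ n]
  note simps = num[folded x_def, simplified] den[folded x_def, simplified]
  have comm: "hyp (5/12) (1/12) 1 = phi"
    by (simp add: phi_def hyp_commute)
  show 1: "psi $ n = phi $ n * (12 * x + 1)"
    using simps(2)[of "5/12" 1] by (simp add: psi_def comm)
  show 2: "hyp (5/12) (13/12) 2 $ n = phi $ n * (12 * x + 1) / (x + 1)"
    using simps(9)[of "5/12" "13/12"] 1 by (simp add: psi_def add.commute)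
  show 3: "hyp (13/12) (17/12) 2 $ n = phi $ n * (12 * x + 1) * (12 * x + 5) / (5 * (x + 1))"
    using simps(3)[of "13/12" 2] 2 x by (simp add: hyp_commute[of "13/12" "17/12"] field_simps)
  show 4: "hyp (13/12) (17/12) 3 $ n = phi $ n * (12 * x + 1) * (12 * x + 5) * 2 / (5 * (x + 1) * (x + 2))"
    using simps(10)[of "13/12" "17/12"] 3 x by (simp add: add.commute mult_ac)
  show 5: "hyp (17/12) (25/12) 3 $ n
      = phi $ n * (12 * x + 1) * (12 * x + 5) * (12 * x + 13) * 2 / (65 * (x + 1) * (x + 2))"
  proof -
    have "hyp (17/12) (25/12) 3 $ n = hyp (13/12) (17/12) 3 $ n * ((12 * x + 13) / 13)"
      using simps(6)[of "17/12" 3] by (simp add: hyp_commute[of "17/12" "13/12"] field_simps)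
    then show ?thesis
      unfolding 4 times_divide_times_eq by (elim trans) (rule arg_cong2[where f = "(/)"]; algebra)
  qed
  show 6: "hyp (17/12) (25/12) 4 $ n
      = phi $ n * (12 * x + 1) * (12 * x + 5) * (12 * x + 13) * 6 / (65 * (x + 1) * (x + 2) * (x + 3))"
    using simps(11)[of "17/12" "25/12"] 5 x by (simp add: add.commute mult_ac)
  show "hyp (25/12) (29/12) 4 $ n = phi $ n * (12 * x + 1) * (12 * x + 5) * (12 * x + 13) * (12 * x + 17) * 6
      / (1105 * (x + 1) * (x + 2) * (x + 3))"
  proof -
    have "hyp (25/12) (29/12) 4 $ n = hyp (17/12) (25/12) 4 $ n * ((12 * x + 17) / 17)"
      using simps(8)[of "25/12" 4] by (simp add: hyp_commute[of "25/12" "17/12"] field_simps)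
    then show ?thesis
      unfolding 6 times_divide_times_eq by (elim trans) (rule arg_cong2[where f = "(/)"]; algebra)
  qed
qed

text \<open>Initial cases of (ii), cleared of \<open>phi\<close>, up to sign and powers of
  \<open>fps_X\<close>; the large constants are the normalizing factors in \<open>N_init\<close>. By
  \<open>hyp_nth_phi\<close> and \<open>phi_nth_Suc\<close> they reduce to identities of rational
  functions of \<open>n\<close>.\<close>

lemma hyp_base:
  "psi - phi = 720 * fps_X * hyp (13/12) (17/12) 2"
  "psi * (1 - 1728 * fps_X) - phi = - 1008 * fps_X * hyp (5/12) (13/12) 2"
  "psi * (1 - 720 * fps_X) - phi = 393120 * fps_X ^ 2 * hyp (17/12) (25/12) 3"
  "psi * (1 - 1728 * fps_X) - phi * (1 - 1008 * fps_X) = - 332640 * fps_X ^ 2 * hyp (13/12) (17/12) 3"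
  "720 * (hyp (13/12) (17/12) 2 * (1 - 1266 * fps_X) - phi) = 147026880 * fps_X ^ 2 * hyp (25/12) (29/12) 4"
  "1008 * (hyp (5/12) (13/12) 2 * (1 - 330 * fps_X) - phi) = 164324160 * fps_X ^ 2 * hyp (17/12) (25/12) 4"
proof -
  \<comment> \<open>The factor \<open>fps_X ^ 2\<close> makes coefficients 0 and 1 special.\<close>
  have 2: "f = g" if "f $ 0 = g $ 0" "f $ 1 = g $ 1" "\<And>n. f $ Suc (Suc n) = g $ Suc (Suc n)" for f g :: "rat fps"
  proof (rule fps_ext)
    fix n show "f $ n = g $ n"
      using that by (cases n; cases "n - 1") auto
  qed
  have expand: "f * (1 - fps_const r * fps_X) = f - fps_const r * (fps_X * f)" for f :: "rat fps" and r
    by (simp add: algebra_simps)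
  have nths: "(f * (1 - fps_const r * fps_X)) $ Suc n = f $ Suc n - r * f $ n"
    "(fps_const r * fps_X * f) $ Suc n = r * f $ n"
    "(fps_const r * fps_X ^ 2 * f) $ Suc (Suc n) = r * f $ n"
    for f :: "rat fps" and r n
    by (simp_all add: expand fps_X_power_mult_nth mult.assoc fps_mult_left_const_nth)
  have nths_0: "(f * (1 - fps_const r * fps_X)) $ 0 = f $ 0" "(fps_const r * fps_X * f) $ 0 = 0"
    "(fps_const r * fps_X ^ 2 * f) $ 0 = 0" "(fps_const r * fps_X ^ 2 * f) $ Suc 0 = 0"
    for f :: "rat fps" and r
    by (simp_all add: expand fps_X_power_mult_nth mult.assoc fps_mult_left_const_nth fps_mult_nth_0)
  have pos: "(of_nat n + 1 :: rat) \<noteq> 0" "(of_nat n + 2 :: rat) \<noteq> 0" "(of_nat n + 3 :: rat) \<noteq> 0" for n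
    using of_nat_0_le_iff[of n, where 'a = rat] by linarith+
  note simps = numeral_fps_const fps_const_neg fps_mult_left_const_nth fps_sub_nth nths nths_0
    hyp_nth_phi phi_nth_Suc of_nat_Suc
  show "psi - phi = 720 * fps_X * hyp (13/12) (17/12) 2"
    by (rule 2; simp only: simps One_nat_def)
      (use pos in \<open>simp_all add: add.assoc divide_simps, simp_all add: algebra_simps power2_eq_square\<close>)
  show "psi * (1 - 1728 * fps_X) - phi = - 1008 * fps_X * hyp (5/12) (13/12) 2"
    by (rule 2; simp only: simps One_nat_def)
      (use pos in \<open>simp_all add: add.assoc divide_simps, simp_all add: algebra_simps power2_eq_square\<close>)
  show "psi * (1 - 720 * fps_X) - phi = 393120 * fps_X ^ 2 * hyp (17/12) (25/12) 3"
    by (rule 2; simp only: simps One_nat_def)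
      (use pos in \<open>simp_all add: add.assoc divide_simps, simp_all add: algebra_simps power2_eq_square\<close>)
  show "psi * (1 - 1728 * fps_X) - phi * (1 - 1008 * fps_X) = - 332640 * fps_X ^ 2 * hyp (13/12) (17/12) 3"
    by (rule 2; simp only: simps One_nat_def)
      (use pos in \<open>simp_all add: add.assoc divide_simps, simp_all add: algebra_simps power2_eq_square\<close>)
  show "720 * (hyp (13/12) (17/12) 2 * (1 - 1266 * fps_X) - phi) = 147026880 * fps_X ^ 2 * hyp (25/12) (29/12) 4"
    by (rule 2; simp only: simps One_nat_def)
      (use pos in \<open>simp_all add: add.assoc divide_simps, simp_all add: algebra_simps power2_eq_square\<close>)
  show "1008 * (hyp (5/12) (13/12) 2 * (1 - 330 * fps_X) - phi) = 164324160 * fps_X ^ 2 * hyp (17/12) (25/12) 4"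
    by (rule 2; simp only: simps One_nat_def)
      (use pos in \<open>simp_all add: add.assoc divide_simps, simp_all add: algebra_simps power2_eq_square\<close>)
qed

section \<open>Families of orthogonal polynomials\<close>

lemma map_poly_const_pCons:
  "map_poly (\<lambda>c. [:c:]) (pCons c F) = pCons [:c:] (map_poly (\<lambda>c. [:c:]) F)" for F :: "rat poly"
  by (rule poly_eqI) (simp add: coeff_map_poly coeff_pCons split: nat.splits)

lemma diff_quot_eqI:
  assumes "Q * [:- pX, 1:] = map_poly (\<lambda>c. [:c:]) F - [:F:]"
  shows "diff_quot F = Q"
  using assms diff_quot_exact[of F] by (metis mult_cancel_right one_neq_zero pCons_eq_0_iff)

lemma diff_quot_diff: "diff_quot (F - G) = diff_quot F - diff_quot G"
proof (rule diff_quot_eqI)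
  have "map_poly (\<lambda>c. [:c:]) (F - G) = map_poly (\<lambda>c. [:c:]) F - map_poly (\<lambda>c. [:c:]) G"
    by (rule poly_eqI) (simp add: coeff_map_poly)
  moreover have "[:F - G:] = [:F:] - [:G:]"
    by simp
  ultimately show "(diff_quot F - diff_quot G) * [:- pX, 1:] = map_poly (\<lambda>c. [:c:]) (F - G) - [:F - G:]"
    by (simp only: left_diff_distrib diff_quot_exact)
qed

lemma diff_quot_smult: "diff_quot (smult c F) = smult [:c:] (diff_quot F)"
proof (rule diff_quot_eqI)
  have "map_poly (\<lambda>c. [:c:]) (smult c F) = smult [:c:] (map_poly (\<lambda>c. [:c:]) F)"
    by (rule poly_eqI) (simp add: coeff_map_poly)
  moreover have "[:smult c F:] = smult [:c:] [:F:]"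
    by simp
  ultimately show "smult [:c:] (diff_quot F) * [:- pX, 1:] = map_poly (\<lambda>c. [:c:]) (smult c F) - [:smult c F:]"
    using diff_quot_exact[of F] by (simp only: mult_smult_left smult_diff_right)
qed

text \<open>Rests on \<open>X F(X) - j F(j) = X (F(X) - F(j)) + (X - j) F(j)\<close>; the constant
  \<open>c\<close> cancels.\<close>

lemma diff_quot_pCons: "diff_quot (pCons c F) = pCons 0 (diff_quot F) + [:F:]"
proof (rule diff_quot_eqI)
  have ring: "(X * D + P) * (X - J) = (X * M + C) - (C + J * P)" if "D * (X - J) = M - P"
    for X D P J M C :: "rat poly poly"
    using that by algebra
  have "[:0, 1:] - [:pX:] = [:- pX, 1:]"
    by simp
  from ring[of "diff_quot F" "[:0, 1:]" "[:pX:]", unfolded this, OF diff_quot_exact, of "[:[:c:]:]"]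
  show "(pCons 0 (diff_quot F) + [:F:]) * [:- pX, 1:]
    = map_poly (\<lambda>c. [:c:]) (pCons c F) - [:pCons c F:]"
    by (simp add: map_poly_const_pCons)
qed

lemma L_j_diff: "L_j (P - Q) = L_j P - L_j Q"
  by (rule poly_eqI) (simp add: coeff_L_j L_fun_diff)

lemma L_j_add: "L_j (P + Q) = L_j P + L_j Q"
  by (rule poly_eqI) (simp add: coeff_L_j L_fun_add)

lemma L_j_smult: "L_j (smult [:c:] P) = smult c (L_j P)"
  by (rule poly_eqI) (simp add: coeff_L_j L_fun_smult)

lemma L_j_pCons: "L_j (pCons c P) = pCons (L_fun c) (L_j P)"
  by (rule poly_eqI) (simp add: coeff_L_j coeff_pCons split: nat.splits)

lemma L_j_diff_quot_pCons: "L_j (diff_quot (pCons c F)) = pCons (L_fun F) (L_j (diff_quot F))"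
  by (simp add: diff_quot_pCons L_j_add L_j_pCons L_fun_0)

lemma L_j_diff_quot_0: "L_j (diff_quot 0) = 0"
  using diff_quot_smult[of 0 0] by (simp add: L_j_def)

text \<open>Compare the coefficients of \<open>fps_X\<close>, as \<open>phi\<close> has constant
  term 1.\<close>

lemma L_fun_eq_of_gen:
  assumes "L_gen P * phi = fps_const c * fps_X * F" "F $ 0 = 1"
  shows "L_fun P = c"
proof -
  have "(L_gen P * phi) $ 1 = L_fun P"
    using L_gen_nth_Suc[of P 0] by (simp add: fps_mult_nth_1)
  then show ?thesis
    using assms by (simp add: mult.assoc fps_mult_left_const_nth)
qed

text \<open>The setting common to the four families: \<open>w\<close> is the weight,
  \<open>N\<close> the values of \<open>L_fun (w * A m * A m)\<close>, and \<open>F\<close> the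
  hypergeometric numerators in (ii). The coefficients in \<open>F_rec\<close> are those of the
  polynomial recurrence.\<close>

locale orthogonal_family =
  fixes w :: "rat poly" and A B :: "nat \<Rightarrow> rat poly" and a c N :: "nat \<Rightarrow> rat"
    and F :: "nat \<Rightarrow> rat fps"
  assumes A_rec: "\<And>n. A (Suc (Suc n)) = [:- a (Suc n), 1:] * A (Suc n) - smult (c (Suc n)) (A n)"
    and B_rec: "\<And>n. B (Suc (Suc n)) = [:- a (Suc n), 1:] * B (Suc n) - smult (c (Suc n)) (B n)"
    and N_rec: "\<And>n. N (Suc n) = c (Suc n) * N n"
    and F_rec: "\<And>n. F (Suc n) - F n
      = fps_X * (fps_const (a (Suc n)) * F (Suc n) + fps_const (c (Suc (Suc n))) * fps_X * F (Suc (Suc n)))"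
    and F_nth_0: "\<And>n. F n $ 0 = 1"
    and A_0: "A 0 = 1" and A_1: "degree (A (Suc 0)) = 1" "coeff (A (Suc 0)) 1 = 1"
    and B_0: "B 0 = L_j (diff_quot w)" and B_1: "B (Suc 0) = L_j (diff_quot (w * A (Suc 0)))"
    and gen_0: "L_gen w * phi = fps_const (N 0) * fps_X * F 0"
    and gen_1: "L_gen (w * A (Suc 0)) * phi = fps_const (N (Suc 0)) * fps_X ^ 2 * F (Suc 0)"
begin

text \<open>Both sides satisfy the three-term relation from \<open>A_rec\<close>: on the right,
  \<open>F_rec\<close> and \<open>N_rec\<close> combine to it.\<close>

lemma gen_mult_phi: "L_gen (w * A m) * phi = fps_const (N m) * fps_X ^ (m + 1) * F m"
proof (induction m rule: induct_nat_012)
  case 0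
  then show ?case using gen_0 by (simp add: A_0)
next
  case 1
  then show ?case using gen_1 by (simp add: numeral_2_eq_2)
next
  case (ge2 n)
  \<comment> \<open>A factor \<open>fps_X ^ 2\<close> splits off, so
    \<open>L_fun (w * A (Suc n))\<close> vanishes and multiplication by \<open>j\<close> is a pure
    shift.\<close>
  have "L_gen (w * A (Suc n)) * phi = fps_const 0 * fps_X * 1 + fps_X * fps_X * (fps_const (N (Suc n)) * fps_X ^ n * F (Suc n))"
    using ge2(2) by (simp add: mult_ac)
  then have "(L_gen (w * A (Suc n)) * phi) $ 1 = 0"
    by (simp add: mult.assoc)
  then have "L_fun (w * A (Suc n)) = 0"
    using L_gen_nth_Suc[of "w * A (Suc n)" 0] by (simp add: fps_mult_nth_1)
  then have shift: "fps_X * L_gen (pX * (w * A (Suc n))) = L_gen (w * A (Suc n))"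
    using L_gen_mult_pX[of "w * A (Suc n)"] by simp
  have "w * A (Suc (Suc n)) = pX * (w * A (Suc n)) - smult (a (Suc n)) (w * A (Suc n)) - smult (c (Suc n)) (w * A n)"
    by (simp add: A_rec algebra_simps)
  then have gen: "L_gen (w * A (Suc (Suc n))) = L_gen (pX * (w * A (Suc n)))
      - fps_const (a (Suc n)) * L_gen (w * A (Suc n)) - fps_const (c (Suc n)) * L_gen (w * A n)"
    by (simp only: L_gen_diff L_gen_smult)
  have N: "fps_const (N (Suc n)) = fps_const (c (Suc n)) * fps_const (N n)"
    "fps_const (N (Suc (Suc n))) = fps_const (c (Suc (Suc n))) * fps_const (N (Suc n))"
    by (simp_all add: N_rec)
  define X where "X = fps_X ^ n * (fps_X :: rat fps)"
  have X: "fps_X ^ (n + 1) = X" "fps_X ^ (Suc n + 1) = X * fps_X" "fps_X ^ (Suc (Suc n) + 1) = X * fps_X * fps_X"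
    by (simp_all add: X_def mult_ac)
  have "fps_X * (L_gen (w * A (Suc (Suc n))) * phi)
    = fps_X * (fps_const (N (Suc (Suc n))) * fps_X ^ (Suc (Suc n) + 1) * F (Suc (Suc n)))"
    using ge2 shift gen N F_rec[of n] unfolding X by algebra
  then show ?case
    by simp
qed

lemma gen: "L_gen (w * A m) = fps_const (N m) * (fps_X ^ (m + 1) * F m / phi)"
proof -
  have "L_gen (w * A m) * phi = (fps_const (N m) * (fps_X ^ (m + 1) * F m / phi)) * phi"
    by (simp add: gen_mult_phi fps_divide_unit mult.assoc inverse_mult_eq_1)
  moreover have "phi \<noteq> 0"
    using phi_psi_nth_0(1) by fastforce
  ultimately show ?thesis
    by simp
qed

text \<open>The series of \<open>w * A m\<close> starts with \<open>N m * fps_X ^ (m + 1)\<close>,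
  and its coefficients are these values.\<close>

lemma L_fun_power: "k \<le> m \<Longrightarrow> L_fun (w * A m * pX ^ k) = (if k = m then N m else 0)"
proof -
  assume "k \<le> m"
  have "L_fun (w * A m * pX ^ k) = L_gen (w * A m) $ Suc k"
    by simp
  also have "\<dots> = N m * (fps_X ^ (m + 1) * (F m * inverse phi)) $ Suc k"
    by (simp only: gen fps_mult_left_const_nth fps_divide_unit phi_psi_nth_0 mult.assoc)
  also have "\<dots> = (if k = m then N m else 0)"
    using \<open>k \<le> m\<close> by (simp only: fps_X_power_mult_nth) (auto simp: F_nth_0)
  finally show ?thesis .
qed

text \<open>Only the top power of \<open>P\<close> survives, by orthogonality to lower
  powers.\<close>

lemma L_fun_mult:
  assumes "degree P \<le> m"
  shows "L_fun (w * A m * P) = coeff P m * N m"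
proof -
  have "P = (\<Sum>i\<le>m. smult (coeff P i) (pX ^ i))"
    using poly_as_sum_of_monoms'[OF assms] by (simp add: monom_altdef)
  then have "w * A m * P = (\<Sum>i\<le>m. smult (coeff P i) (w * A m * pX ^ i))"
    by (metis (mono_tags, lifting) mult_smult_right sum.cong sum_distrib_left)
  then have "L_fun (w * A m * P) = (\<Sum>i\<le>m. coeff P i * (if i = m then N m else 0))"
    by (simp add: L_fun_sum L_fun_smult L_fun_power)
  also have "\<dots> = coeff P m * N m"
    by (simp add: if_distrib cong: if_cong)
  finally show ?thesis .
qed

lemma monic: "degree (A n) = n \<and> coeff (A n) n = 1"
proof (induction n rule: induct_nat_012)
  case (ge2 n)
  have X: "[:- a (Suc n), 1:] * A (Suc n) = pCons 0 (A (Suc n)) - smult (a (Suc n)) (A (Suc n))"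
    by simp
  have vanish: "coeff (A (Suc n)) k = 0" if "Suc n < k" for k
    using ge2 that by (simp add: coeff_eq_0)
  moreover have "coeff (A n) k = 0" if "n < k" for k
    using ge2 that by (simp add: coeff_eq_0)
  ultimately have "coeff (A (Suc (Suc n))) k = (if k = Suc (Suc n) then 1 else 0)" if "Suc n < k" for k
    using that ge2 unfolding A_rec X by (cases k) auto
  then have "coeff (A (Suc (Suc n))) (Suc (Suc n)) = 1" "degree (A (Suc (Suc n))) \<le> Suc (Suc n)"
    by (auto intro!: degree_le)
  then show ?case
    by (metis le_antisym le_degree zero_neq_one)
qed (use A_0 A_1 in auto)

text \<open>By symmetry take \<open>n \<le> m\<close>; as \<open>A n\<close> is monic of degree
  \<open>n\<close>, its coefficient at \<open>m\<close> is \<open>delta m n\<close>.\<close>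

lemma orthogonal: "L_fun (w * A m * A n) = N m * delta m n"
proof -
  have *: "L_fun (w * A m * A n) = N m * delta m n" if "n \<le> m" for m n
    using L_fun_mult[of "A n" m] monic[of n] that by (auto simp: delta_def coeff_eq_0)
  show ?thesis
  proof (cases "n \<le> m")
    case False
    then show ?thesis
      using *[of m n] by (simp add: mult_ac delta_def)
  qed (rule *)
qed

text \<open>Multiplying by \<open>j\<close> adds the constant
  \<open>L_fun (w * A (Suc n)) = 0\<close> to the shifted polynomial, so the right side satisfies
  the recurrence of \<open>B\<close>.\<close>

lemma B_eq: "B m = L_j (diff_quot (w * A m))"
proof (induction m rule: induct_nat_012)
  case (ge2 n)
  have "w * A (Suc (Suc n)) = pCons 0 (w * A (Suc n)) - smult (a (Suc n)) (w * A (Suc n)) - smult (c (Suc n)) (w * A n)"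
    by (simp add: A_rec algebra_simps)
  moreover have "L_fun (w * A (Suc n)) = 0"
    using L_fun_power[of 0 "Suc n"] by simp
  ultimately show ?case
    using ge2 by (simp add: L_j_diff_quot_pCons diff_quot_diff diff_quot_smult L_j_diff L_j_smult B_rec)
qed (use A_0 B_0 B_1 in auto)

end

section \<open>The four families\<close>

text \<open>With parameters \<open>n + p\<close>, \<open>n + q\<close>, \<open>2 n + r\<close>,
  raising \<open>n\<close> by one is the parameter shift of \<open>hyp_three_term\<close>. The
  equations for \<open>a\<close> and \<open>c\<close> leave only identities of rational functions to
  check.\<close>

lemma hyp_family_three_term:
  fixes p q r :: rat and n :: nat
  defines "F \<equiv> \<lambda>n. hyp (of_nat n + p) (of_nat n + q) (2 * of_nat n + r)"
    and "x \<equiv> of_nat n :: rat"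
  assumes "0 < r"
    and "a = 1728 * ((x + p) * (x + r - q) / ((2 * x + r) * (2 * x + r + 1))
      + (x + q + 1) * (x + r + 1 - p) / ((2 * x + r + 1) * (2 * x + r + 2)))"
    and "c = 1728 ^ 2 * ((x + q + 1) * (x + r + 1 - p) * (x + p + 1) * (x + r + 1 - q))
      / ((2 * x + r + 1) * (2 * x + r + 2) ^ 2 * (2 * x + r + 3))"
  shows "F (Suc n) - F n
    = fps_X * (fps_const a * F (Suc n) + fps_const c * fps_X * F (Suc (Suc n)))"
proof -
  have pos: "0 < 2 * x + r"
    using assms(3) by (simp add: x_def add_nonneg_pos)
  have 1: "of_nat (Suc n) + p = x + p + 1" "of_nat (Suc n) + q = x + q + 1"
    "2 * of_nat (Suc n) + r = 2 * x + r + 2" "of_nat (Suc (Suc n)) + p = x + p + 2"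
    "of_nat (Suc (Suc n)) + q = x + q + 2" "2 * of_nat (Suc (Suc n)) + r = 2 * x + r + 4"
    by (simp_all add: x_def)
  have numerators: "1728 * (x + p) * (2 * x + r - (x + q)) = 1728 * ((x + p) * (x + r - q))"
    "1728 * (x + q + 1) * (2 * x + r + 1 - (x + p)) = 1728 * ((x + q + 1) * (x + r + 1 - p))"
    by algebra+
  have 2: "a = 1728 * (x + p) * (2 * x + r - (x + q)) / ((2 * x + r) * (2 * x + r + 1))
      + 1728 * (x + q + 1) * (2 * x + r + 1 - (x + p)) / ((2 * x + r + 1) * (2 * x + r + 2))"
    unfolding assms(4) numerators by (subst distrib_left) (simp only: times_divide_eq_right)
  have 3: "c = 1728 * (x + q + 1) * (2 * x + r + 1 - (x + p)) / ((2 * x + r + 1) * (2 * x + r + 2))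
      * (1728 * (x + p + 1) * (2 * x + r + 1 - (x + q)) / ((2 * x + r + 2) * (2 * x + r + 3)))"
    unfolding assms(5) times_divide_times_eq
    by (rule arg_cong2[where f = "(/)"]; algebra)
  show ?thesis
    unfolding F_def 1 2 3 x_def[symmetric] by (rule hyp_three_term[OF pos])
qed

section \<open>Recurrences of the normalizing factors\<close>

definition norm_seq :: "nat \<Rightarrow> rat" where
  "norm_seq n = of_nat (12 * n * ((3 * n) choose n) * ((6 * n) choose (3 * n)))"

lemma norm_seq_fact:
  "norm_seq n = 12 * of_nat n * fact (6 * n) / (fact n * fact (2 * n) * fact (3 * n))"
proof -
  have "of_nat ((3 * n) choose n) = (fact (3 * n) / (fact n * fact (2 * n)) :: rat)"
    using binomial_fact[of n "3 * n", where 'a = rat] by simp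
  moreover have "of_nat ((6 * n) choose (3 * n)) = (fact (6 * n) / (fact (3 * n) * fact (3 * n)) :: rat)"
    using binomial_fact[of "3 * n" "6 * n", where 'a = rat] by simp
  ultimately show ?thesis
    by (simp add: norm_seq_def)
qed

text \<open>Quotient of consecutive factorial expressions. At \<open>n = 0\<close> both sides
  vanish, so the recursion starts at \<open>n = 1\<close>.\<close>

lemma norm_seq_Suc:
  "of_nat n * (of_nat n + 1) * norm_seq (Suc n) = 12 * (6 * of_nat n + 1) * (6 * of_nat n + 5) * norm_seq n"
proof -
  define x :: rat where "x = of_nat n"
  have x: "0 \<le> x" by (simp add: x_def)
  have f6: "(fact (6 * Suc n) :: rat) = (6*x+6)*(6*x+5)*(6*x+4)*(6*x+3)*(6*x+2)*(6*x+1) * fact (6 * n)"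
    by (simp add: x_def eval_nat_numeral) (simp add: algebra_simps)
  have f3: "(fact (3 * Suc n) :: rat) = (3*x+3)*(3*x+2)*(3*x+1) * fact (3 * n)"
    by (simp add: x_def eval_nat_numeral) (simp add: algebra_simps)
  have f2: "(fact (2 * Suc n) :: rat) = (2*x+2)*(2*x+1) * fact (2 * n)"
    by (simp add: x_def eval_nat_numeral) (simp add: algebra_simps)
  have f1: "(fact (Suc n) :: rat) = (x+1) * fact n"
    by (simp add: x_def algebra_simps)
  have ne: "x + 1 \<noteq> 0" "2 * x + 1 \<noteq> 0" "3 * x + 1 \<noteq> 0" "3 * x + 2 \<noteq> 0" "2 * x + 2 \<noteq> 0" "3 * x + 3 \<noteq> 0"
    using x by linarith+
  show ?thesis
    unfolding norm_seq_fact f1 f2 f3 f6 of_nat_Suc x_def[symmetric]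
    using ne by (simp add: divide_simps) (simp add: algebra_simps)
qed

lemma N0_eq: "0 < m \<Longrightarrow> N0 m = norm_seq (2 * m)"
  by (simp add: N0_def norm_seq_def mult_ac)

lemma N6_eq: "N6 m = norm_seq (2 * m + 1)"
proof -
  have "3 * (2 * m + 1) = 6 * m + 3" "6 * (2 * m + 1) = 12 * m + 6"
    by simp_all
  then show ?thesis
    unfolding N6_def norm_seq_def by (simp only:)
qed

text \<open>With \<open>n + 2 = 2 x\<close> the factor is \<open>rb0 x\<close>: even
  \<open>n\<close> gives the recurrence of \<open>N0\<close>, odd \<open>n\<close> that of
  \<open>N6\<close>, which explains the shift by \<open>1/2\<close>.\<close>

lemma norm_seq_Suc_Suc:
  fixes n :: nat
  defines "x \<equiv> of_nat n :: rat"
  assumes "0 < n"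
  shows "norm_seq (Suc (Suc n)) = 144 * (6 * x + 1) * (6 * x + 5) * (6 * x + 7) * (6 * x + 11)
      / (x * (x + 1) ^ 2 * (x + 2)) * norm_seq n"
proof -
  have x: "0 < x"
    using assms by (simp add: x_def)
  have 1: "norm_seq (Suc n) = 12 * (6 * x + 1) * (6 * x + 5) * norm_seq n / (x * (x + 1))"
    using norm_seq_Suc[of n, folded x_def] x by (simp add: nonzero_eq_divide_eq mult_ac)
  have "(x + 1) * (x + 2) * norm_seq (Suc (Suc n)) = 12 * (6 * x + 7) * (6 * x + 11) * norm_seq (Suc n)"
    using norm_seq_Suc[of "Suc n"] by (simp add: x_def[symmetric] algebra_simps)
  then have "norm_seq (Suc (Suc n)) = 12 * (6 * x + 7) * (6 * x + 11) * norm_seq (Suc n) / ((x + 1) * (x + 2))"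
    using x by (simp add: nonzero_eq_divide_eq mult_ac)
  then show ?thesis
    unfolding 1 using x by (simp add: field_simps power2_eq_square)
qed

lemma N0_Suc_Suc: "N0 (Suc (Suc n)) = b0 (n + 2) * N0 (Suc n)"
proof -
  define x :: rat where "x = of_nat n"
  have x: "0 \<le> x" by (simp add: x_def)
  have "2 * Suc (Suc n) = Suc (Suc (2 * Suc n))" by simp
  then have "N0 (Suc (Suc n)) = 144 * (12 * x + 13) * (12 * x + 17) * (12 * x + 19) * (12 * x + 23)
      / ((2 * x + 2) * (2 * x + 3) ^ 2 * (2 * x + 4)) * N0 (Suc n)"
    unfolding N0_eq[OF zero_less_Suc] using norm_seq_Suc_Suc[of "2 * Suc n"]
    by (simp only: zero_less_mult_iff) (simp add: x_def add_ac)
  moreover have "144 * (12 * x + 13) * (12 * x + 17) * (12 * x + 19) * (12 * x + 23)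
      / ((2 * x + 2) * (2 * x + 3) ^ 2 * (2 * x + 4)) = b0 (n + 2)"
    using x unfolding b0_def rb0_def by (simp add: x_def[symmetric] divide_simps add_ac) (simp add: algebra_simps power2_eq_square)
  ultimately show ?thesis by (simp only:)
qed

lemma N6_Suc: "N6 (Suc n) = b6 (Suc n) * N6 n"
proof -
  define x :: rat where "x = of_nat n"
  have x: "0 \<le> x" by (simp add: x_def)
  have "2 * Suc n + 1 = Suc (Suc (2 * n + 1))" by simp
  then have "N6 (Suc n) = 144 * (12 * x + 7) * (12 * x + 11) * (12 * x + 13) * (12 * x + 17)
      / ((2 * x + 1) * (2 * x + 2) ^ 2 * (2 * x + 3)) * N6 n"
    unfolding N6_eq using norm_seq_Suc_Suc[of "2 * n + 1"]
    by (simp only: zero_less_Suc Suc_eq_plus1[symmetric]) (simp add: x_def add_ac)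
  moreover have "144 * (12 * x + 7) * (12 * x + 11) * (12 * x + 13) * (12 * x + 17)
      / ((2 * x + 1) * (2 * x + 2) ^ 2 * (2 * x + 3)) = b6 (Suc n)"
    using x unfolding b6_def rb0_def by (simp add: x_def[symmetric] divide_simps add_ac) (simp add: algebra_simps power2_eq_square)
  ultimately show ?thesis by (simp only:)
qed

text \<open>The prefactors \<open>(12 x + 1) / (12 x - 1)\<close> at \<open>x\<close> and
  \<open>x - 1\<close> have the quotient \<open>rb2 x / rb0 x\<close>.\<close>

lemma N2_Suc_Suc: "N2 (Suc (Suc n)) = b2 (n + 2) * N2 (Suc n)"
proof -
  define x :: rat where "x = of_nat n"
  have x: "0 \<le> x" by (simp add: x_def)
  have "(12 * x + 25) / (12 * x + 23) * b0 (n + 2) = b2 (n + 2) * ((12 * x + 13) / (12 * x + 11))"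
    using x unfolding b0_def rb0_def b2_def rb2_def
    by (simp add: x_def[symmetric] divide_simps add_ac) (simp add: algebra_simps power2_eq_square)
  moreover have "N2 (Suc (Suc n)) = (12 * x + 25) / (12 * x + 23) * b0 (n + 2) * N0 (Suc n)"
    "N2 (Suc n) = (12 * x + 13) / (12 * x + 11) * N0 (Suc n)"
    by (simp_all add: N2_def N0_Suc_Suc x_def algebra_simps)
  ultimately show ?thesis
    by (simp only: mult.assoc)
qed

text \<open>The same quotient of prefactors, at \<open>x\<close> half an odd integer.\<close>

lemma N8_Suc: "N8 (Suc n) = b8 (Suc n) * N8 n"
proof -
  define x :: rat where "x = of_nat n"
  have x: "0 \<le> x" by (simp add: x_def)
  have "(12 * x + 19) / (12 * x + 17) * b6 (Suc n) = b8 (Suc n) * ((12 * x + 7) / (12 * x + 5))"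
    using x unfolding b6_def rb0_def b8_def rb2_def
    by (simp add: x_def[symmetric] divide_simps add_ac) (simp add: algebra_simps power2_eq_square)
  moreover have "N8 (Suc n) = (12 * x + 19) / (12 * x + 17) * b6 (Suc n) * N6 n"
    "N8 n = (12 * x + 7) / (12 * x + 5) * N6 n"
    by (simp_all add: N8_def N6_Suc x_def algebra_simps)
  ultimately show ?thesis
    by (simp only: mult.assoc)
qed

lemma N_init: "N0 1 = 332640" "N2 0 = 1" "N2 1 = 393120" "N6 0 = 720" "N6 1 = 147026880"
  "N8 0 = 1008" "N8 1 = 164324160"
proof -
  have 2: "norm_seq 1 = 720"
    by (simp add: norm_seq_def eval_nat_numeral)
  show 0: "N0 1 = 332640"
    using norm_seq_Suc[of 1] 2 by (simp add: N0_eq eval_nat_numeral)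
  show "N2 0 = 1" "N2 1 = 393120"
    using 0 by (simp_all add: N2_def)
  show 3: "N6 0 = 720"
    using 2 by (simp add: N6_eq)
  show 4: "N6 1 = 147026880"
    using N6_Suc[of 0] 3 by (simp add: b6_def rb0_def power2_eq_square)
  show "N8 0 = 1008" "N8 1 = 164324160"
    using 3 4 by (simp_all add: N8_def)
qed

section \<open>Initial values of the four families\<close>

lemma L_gen_1_phi: "L_gen 1 * phi = fps_X * psi"
  by (simp add: L_gen_1 mult.assoc riccati_H_mult)

lemma L_gen_mult_pX_phi:
  assumes "L_gen P * phi = fps_const c * fps_X * F" "F $ 0 = 1"
  shows "L_gen (pX * P) * phi = fps_const c * (F - phi)"
proof -
  have "fps_X * (L_gen (pX * P) * phi) = fps_X * (fps_const c * (F - phi))"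
    using L_gen_mult_pX[of P, unfolded L_fun_eq_of_gen[OF assms]] assms(1) by algebra
  then show ?thesis
    by simp
qed

lemma L_gen_mult_linear_phi:
  assumes "L_gen P * phi = fps_const c * fps_X * F" "F $ 0 = 1"
  shows "L_gen ([:- d, 1:] * P) * phi = fps_const c * (F * (1 - fps_const d * fps_X) - phi)"
proof -
  have "[:- d, 1:] * P = pX * P - smult d P"
    by simp
  then have "L_gen ([:- d, 1:] * P) = L_gen (pX * P) - fps_const d * L_gen P"
    by (simp only: L_gen_diff L_gen_smult)
  then show ?thesis
    using L_gen_mult_pX_phi[OF assms] assms(1) by algebra
qed

lemma gen_base:
  "L_gen 1 * phi = fps_const 1 * fps_X * psi"
  "L_gen pX * phi = fps_const 720 * fps_X * hyp (13/12) (17/12) 2"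
  "L_gen pX1728 * phi = fps_const (- 1008) * fps_X * hyp (5/12) (13/12) 2"
  "L_gen (pX * pX1728) * phi = fps_const (- 332640) * fps_X * hyp (13/12) (17/12) 3"
proof -
  show 1: "L_gen 1 * phi = fps_const 1 * fps_X * psi"
    by (simp add: L_gen_1_phi)
  show 2: "L_gen pX * phi = fps_const 720 * fps_X * hyp (13/12) (17/12) 2"
    using L_gen_mult_pX_phi[OF 1] hyp_base(1) by (simp add: numeral_fps_const)
  show 3: "L_gen pX1728 * phi = fps_const (- 1008) * fps_X * hyp (5/12) (13/12) 2"
    using L_gen_mult_linear_phi[OF 1, of 1728] hyp_base(2) by (simp add: numeral_fps_const)
  have "L_gen (pX1728 * pX) * phi = fps_const 720 * (hyp (13/12) (17/12) 2 * (1 - fps_const 1728 * fps_X) - phi)"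
    using L_gen_mult_linear_phi[OF 2, of 1728] by simp
  \<comment> \<open>Multiplying by \<open>fps_X\<close> allows
    \<open>720 * fps_X * hyp (13/12) (17/12) 2\<close> to be replaced by
    \<open>psi - phi\<close>.\<close>
  then have "fps_X * (L_gen (pX * pX1728) * phi) = fps_X * (- 332640 * fps_X * hyp (13/12) (17/12) 3)"
    using hyp_base(1,4) unfolding mult.commute[of pX pX1728] numeral_fps_const[symmetric] by algebra
  then have "L_gen (pX * pX1728) * phi = - 332640 * fps_X * hyp (13/12) (17/12) 3"
    by (simp only: mult_cancel_left) simp
  then show "L_gen (pX * pX1728) * phi = fps_const (- 332640) * fps_X * hyp (13/12) (17/12) 3"
    by (simp only: numeral_fps_const fps_const_neg)
qed

text \<open>The moments of degree at most 2, which evaluate the initial \<open>B\<close>;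
  \<open>911520 = 1728 * 720 - 332640\<close>.\<close>

lemma L_fun_quadratic: "L_fun [:c, d, e:] = c + 720 * d + 911520 * e"
proof -
  have "[:c, d, e:] = smult c 1 + smult (d + 1728 * e) pX + smult e (pX * pX1728)"
    by (simp add: one_pCons)
  moreover have "L_fun 1 = 1" "L_fun pX = 720" "L_fun (pX * pX1728) = - 332640"
    using gen_base(1,2,4)[THEN L_fun_eq_of_gen] by simp_all
  ultimately show ?thesis
    by (simp only: L_fun_add L_fun_smult) (simp add: algebra_simps)
qed

lemma L_fun_linear: "L_fun [:c, d:] = c + 720 * d" "L_fun [:c:] = c"
  using L_fun_quadratic[of c d 0] L_fun_quadratic[of c 0 0] by simp_all

lemmas L_j_diff_quot_eval = L_j_diff_quot_pCons L_j_diff_quot_0 L_fun_linear L_fun_quadratic L_fun_0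

text \<open>Extends the numerators of the first family to \<open>m = -1\<close>, where they give
  \<open>phi\<close>; the constants are \<open>a0 1\<close> and \<open>b0 2\<close>.\<close>

lemma phi_three_term: "hyp (13/12) (17/12) 3 * (1 - 824 * fps_X) - phi = 193154 * fps_X ^ 2 * hyp (25/12) (29/12) 5"
  using hyp_three_term[of 1 "1/12" "5/12"] unfolding phi_def
  by (simp add: numeral_fps_const algebra_simps power2_eq_square)

text \<open>The index is shifted by one since \<open>A0 0 = 0\<close>. The locale then evaluates
  \<open>b0\<close> from \<open>b0 2\<close> on, away from its pole.\<close>

interpretation r0: orthogonal_family "pX * pX1728" "\<lambda>m. A0 (Suc m)" "\<lambda>m. B0 (Suc m)"
  "\<lambda>n. a0 (n + 1)" "\<lambda>n. b0 (n + 1)" "\<lambda>m. - N0 (Suc m)"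
  "\<lambda>n. hyp (of_nat n + 13/12) (of_nat n + 17/12) (2 * of_nat n + 3)"
proof
  fix n
  show "- N0 (Suc (Suc n)) = b0 (Suc n + 1) * - N0 (Suc n)"
    by (simp add: N0_Suc_Suc)
  define x :: rat where "x = of_nat n"
  have x: "0 \<le> x" by (simp add: x_def)
  show "hyp (of_nat (Suc n) + 13/12) (of_nat (Suc n) + 17/12) (2 * of_nat (Suc n) + 3)
      - hyp (of_nat n + 13/12) (of_nat n + 17/12) (2 * of_nat n + 3)
    = fps_X * (fps_const (a0 (Suc n + 1)) * hyp (of_nat (Suc n) + 13/12) (of_nat (Suc n) + 17/12) (2 * of_nat (Suc n) + 3)
      + fps_const (b0 (Suc (Suc n) + 1)) * fps_X
        * hyp (of_nat (Suc (Suc n)) + 13/12) (of_nat (Suc (Suc n)) + 17/12) (2 * of_nat (Suc (Suc n)) + 3))"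
    using x unfolding a0_def ra0_def b0_def rb0_def
    by (intro hyp_family_three_term; simp add: x_def[symmetric] add_ac divide_simps; simp add: algebra_simps power2_eq_square)
next
  have "pX * pX1728 * A0 (Suc (Suc 0)) = [:- 824, 1:] * (pX * pX1728)"
    by simp
  then have "L_gen (pX * pX1728 * A0 (Suc (Suc 0))) * phi
      = fps_const (- 332640) * (193154 * fps_X ^ 2 * hyp (25/12) (29/12) 5)"
    using L_gen_mult_linear_phi[OF gen_base(4), of 824] phi_three_term by (simp only: numeral_fps_const hyp_nth_0)
  also have "\<dots> = fps_const (- N0 (Suc (Suc 0))) * fps_X ^ 2 * hyp (25/12) (29/12) 5"
    using N_init(1) by (simp add: N0_Suc_Suc b0_def rb0_def numeral_fps_const power2_eq_square mult.assoc[symmetric])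
  finally show "L_gen (pX * pX1728 * A0 (Suc (Suc 0))) * phi
    = fps_const (- N0 (Suc (Suc 0))) * fps_X ^ 2 * hyp (of_nat (Suc 0) + 13/12) (of_nat (Suc 0) + 17/12) (2 * of_nat (Suc 0) + 3)"
    by simp
qed (use N_init gen_base in \<open>simp_all add: L_j_diff_quot_eval\<close>)

text \<open>
  The value of \<open>b2 1\<close> is a division by zero; the recurrence extends to \<open>n = 1\<close> with \<open>N2 1 / N2 0 = 393120\<close>.
\<close>
interpretation r2: orthogonal_family 1 A2 B2 a2 "\<lambda>n. if n = 1 then 393120 else b2 n" N2
  "\<lambda>n. hyp (of_nat n + 5/12) (of_nat n + 13/12) (2 * of_nat n + 1)"
proof
  fix n
  show "A2 (Suc (Suc n)) = [:- a2 (Suc n), 1:] * A2 (Suc n) - smult (if Suc n = 1 then 393120 else b2 (Suc n)) (A2 n)"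
    \<comment> \<open>For \<open>n = 0\<close>: \<open>a2 1 = 920\<close>, and
      \<open>(X - 920) (X - 720) - 393120\<close> is the prescribed \<open>A2 2\<close>.\<close>
    by (cases n) (simp_all add: a2_def ra2_def)
  show "B2 (Suc (Suc n)) = [:- a2 (Suc n), 1:] * B2 (Suc n) - smult (if Suc n = 1 then 393120 else b2 (Suc n)) (B2 n)"
    by (cases n) (simp_all add: a2_def ra2_def)
  show "N2 (Suc n) = (if Suc n = 1 then 393120 else b2 (Suc n)) * N2 n"
    using N_init(2,3) by (cases n) (simp_all add: N2_Suc_Suc)
  define x :: rat where "x = of_nat n"
  have x: "0 \<le> x" by (simp add: x_def)
  show "hyp (of_nat (Suc n) + 5/12) (of_nat (Suc n) + 13/12) (2 * of_nat (Suc n) + 1)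
      - hyp (of_nat n + 5/12) (of_nat n + 13/12) (2 * of_nat n + 1)
    = fps_X * (fps_const (a2 (Suc n)) * hyp (of_nat (Suc n) + 5/12) (of_nat (Suc n) + 13/12) (2 * of_nat (Suc n) + 1)
      + fps_const (if Suc (Suc n) = 1 then 393120 else b2 (Suc (Suc n))) * fps_X
        * hyp (of_nat (Suc (Suc n)) + 5/12) (of_nat (Suc (Suc n)) + 13/12) (2 * of_nat (Suc (Suc n)) + 1))"
    using x unfolding a2_def ra2_def b2_def rb2_def
    by (intro hyp_family_three_term; simp add: x_def[symmetric] add_ac divide_simps; simp add: algebra_simps power2_eq_square)
next
  have "L_gen (1 * A2 (Suc 0)) * phi = fps_const 1 * (psi * (1 - fps_const 720 * fps_X) - phi)"
    using L_gen_mult_linear_phi[OF gen_base(1), of 720] by simp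
  also have "\<dots> = fps_const (N2 (Suc 0)) * fps_X ^ 2 * hyp (17/12) (25/12) 3"
    using N_init(3) hyp_base(3) by (simp add: numeral_fps_const)
  finally show "L_gen (1 * A2 (Suc 0)) * phi
    = fps_const (N2 (Suc 0)) * fps_X ^ 2 * hyp (of_nat (Suc 0) + 5/12) (of_nat (Suc 0) + 13/12) (2 * of_nat (Suc 0) + 1)"
    by simp
qed (use N_init gen_base in \<open>simp_all add: L_j_diff_quot_eval one_pCons psi_def\<close>)

text \<open>The recurrence of the polynomials starts at \<open>n = 1\<close>, as in the locale. The
  case of \<open>A6 1\<close> is \<open>hyp_base(5)\<close>.\<close>

interpretation r6: orthogonal_family pX A6 B6 a6 b6 N6
  "\<lambda>n. hyp (of_nat n + 13/12) (of_nat n + 17/12) (2 * of_nat n + 2)"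
proof
  fix n
  define x :: rat where "x = of_nat n"
  have x: "0 \<le> x" by (simp add: x_def)
  show "hyp (of_nat (Suc n) + 13/12) (of_nat (Suc n) + 17/12) (2 * of_nat (Suc n) + 2)
      - hyp (of_nat n + 13/12) (of_nat n + 17/12) (2 * of_nat n + 2)
    = fps_X * (fps_const (a6 (Suc n)) * hyp (of_nat (Suc n) + 13/12) (of_nat (Suc n) + 17/12) (2 * of_nat (Suc n) + 2)
      + fps_const (b6 (Suc (Suc n))) * fps_X
        * hyp (of_nat (Suc (Suc n)) + 13/12) (of_nat (Suc (Suc n)) + 17/12) (2 * of_nat (Suc (Suc n)) + 2))"
    using x unfolding a6_def ra0_def b6_def rb0_def
    by (intro hyp_family_three_term; simp add: x_def[symmetric] add_ac divide_simps; simp add: algebra_simps power2_eq_square)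
next
  have "L_gen (pX * A6 (Suc 0)) * phi = fps_const 720 * (hyp (13/12) (17/12) 2 * (1 - fps_const 1266 * fps_X) - phi)"
    using L_gen_mult_linear_phi[OF gen_base(2), of 1266] by (simp add: mult.commute[of pX])
  also have "\<dots> = fps_const (N6 (Suc 0)) * fps_X ^ 2 * hyp (25/12) (29/12) 4"
    using N_init(5) hyp_base(5) by (simp add: numeral_fps_const)
  finally show "L_gen (pX * A6 (Suc 0)) * phi
    = fps_const (N6 (Suc 0)) * fps_X ^ 2 * hyp (of_nat (Suc 0) + 13/12) (of_nat (Suc 0) + 17/12) (2 * of_nat (Suc 0) + 2)"
    by simp
qed (use N_init gen_base N6_Suc in \<open>simp_all add: L_j_diff_quot_eval\<close>)

text \<open>The sign of the norms comes from
  \<open>L_fun pX1728 = 720 - 1728 = - 1008\<close>.\<close>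

interpretation r8: orthogonal_family pX1728 A8 B8 a8 b8 "\<lambda>m. - N8 m"
  "\<lambda>n. hyp (of_nat n + 5/12) (of_nat n + 13/12) (2 * of_nat n + 2)"
proof
  fix n
  define x :: rat where "x = of_nat n"
  have x: "0 \<le> x" by (simp add: x_def)
  show "hyp (of_nat (Suc n) + 5/12) (of_nat (Suc n) + 13/12) (2 * of_nat (Suc n) + 2)
      - hyp (of_nat n + 5/12) (of_nat n + 13/12) (2 * of_nat n + 2)
    = fps_X * (fps_const (a8 (Suc n)) * hyp (of_nat (Suc n) + 5/12) (of_nat (Suc n) + 13/12) (2 * of_nat (Suc n) + 2)
      + fps_const (b8 (Suc (Suc n))) * fps_X
        * hyp (of_nat (Suc (Suc n)) + 5/12) (of_nat (Suc (Suc n)) + 13/12) (2 * of_nat (Suc (Suc n)) + 2))"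
    using x unfolding a8_def ra2_def b8_def rb2_def
    by (intro hyp_family_three_term; simp add: x_def[symmetric] add_ac divide_simps; simp add: algebra_simps power2_eq_square)
next
  have "L_gen (pX1728 * A8 (Suc 0)) * phi = fps_const (- 1008) * (hyp (5/12) (13/12) 2 * (1 - fps_const 330 * fps_X) - phi)"
    using L_gen_mult_linear_phi[OF gen_base(3), of 330] by (simp add: mult.commute[of pX1728])
  also have "\<dots> = fps_const (- N8 (Suc 0)) * fps_X ^ 2 * hyp (17/12) (25/12) 4"
    using N_init(7) hyp_base(6) by (simp add: numeral_fps_const fps_const_neg[symmetric] del: fps_const_neg)
  finally show "L_gen (pX1728 * A8 (Suc 0)) * phi
    = fps_const (- N8 (Suc 0)) * fps_X ^ 2 * hyp (of_nat (Suc 0) + 5/12) (of_nat (Suc 0) + 13/12) (2 * of_nat (Suc 0) + 2)"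
    by simp
qed (use N_init gen_base N8_Suc in \<open>simp_all add: L_j_diff_quot_eval\<close>)

theorem theorem3p4:
  shows
    "(\<forall>m. B0 (m + 1) = L_j (diff_quot (pX * pX1728 * A0 (m + 1)))
        \<and> B2 m = L_j (diff_quot (A2 m))
        \<and> B6 m = L_j (diff_quot (pX * A6 m))
        \<and> B8 m = L_j (diff_quot (pX1728 * A8 m)))
   \<and> (\<forall>m. L_gen (pX * pX1728 * A0 (m + 1))
            = - fps_const (N0 (m + 1))
              * (fps_X ^ (m + 1) * hyp (of_nat m + 13/12) (of_nat m + 17/12) (2 * of_nat m + 3)
                 / hyp (1/12) (5/12) 1)
        \<and> L_gen (A2 m)
            = fps_const (N2 m)
              * (fps_X ^ (m + 1) * hyp (of_nat m + 5/12) (of_nat m + 13/12) (2 * of_nat m + 1)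
                 / hyp (1/12) (5/12) 1)
        \<and> L_gen (pX * A6 m)
            = fps_const (N6 m)
              * (fps_X ^ (m + 1) * hyp (of_nat m + 13/12) (of_nat m + 17/12) (2 * of_nat m + 2)
                 / hyp (1/12) (5/12) 1)
        \<and> L_gen (pX1728 * A8 m)
            = - fps_const (N8 m)
              * (fps_X ^ (m + 1) * hyp (of_nat m + 5/12) (of_nat m + 13/12) (2 * of_nat m + 2)
                 / hyp (1/12) (5/12) 1))
   \<and> (\<forall>m n. L_fun (pX * pX1728 * A0 (m + 1) * A0 (n + 1)) = - N0 (m + 1) * delta m n
        \<and> L_fun (A2 m * A2 n) = N2 m * delta m n
        \<and> L_fun (pX * A6 m * A6 n) = N6 m * delta m n
        \<and> L_fun (pX1728 * A8 m * A8 n) = - N8 m * delta m n)"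

  \<comment> \<open>The common denominator in (ii) is \<open>phi\<close>; negative norms enter the
    interpretations inside \<open>fps_const\<close>.\<close>
  using r0.B_eq r2.B_eq r6.B_eq r8.B_eq r0.gen r2.gen r6.gen r8.gen
    r0.orthogonal r2.orthogonal r6.orthogonal r8.orthogonal
  by (simp add: phi_def fps_const_neg[symmetric] del: fps_const_neg)

end
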